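(* For every $\delta>0$ there exists $\tau>0$ such that for every $\nu>0$ there exist $n_0\in\mathbb{N}$ and a function $\eta:\mathbb{N}\to[0,\infty)$ with $\eta(n)\to 0$ as $n\to\infty$ (both depending only on $\delta,\tau,\nu$) for which the following holds. Let $n\ge n_0$ be even and let $d\ge \delta n$. Then for every $d$-regular robust $(\nu,\tau)$-expander $G$ on $n$ vertices, every edge $e\in E(G)$, and $M$ chosen uniformly at random from the set of all perfect matchings of $G$, we have $$\left|\,d\cdot\mathbb{P}[e\in M]-1\,\right|\le \eta(n),$$ that is, $\mathbb{P}[e\in M]=(1+o_n(1))d^{-1}$.
   Context: All graphs are finite and simple. Let $\nu,\tau>0$ and let $G$ be a graph on $n$ vertices. For $S\subseteq V(G)$, the $\nu$-robust neighbourhood $RN_{\nu,G}(S)$ of $S$ in $G$ is the set of vertices of $G$ which have at least $\nu n$ neighbours in $S$. The graph $G$ is a robust $(\nu,\tau)$-expander if $|RN_{\nu,G}(S)|\ge |S|+\nu n$ for every $S\subseteq V(G)$ with $\tau n\le |S|\le (1-\tau)n$. Perfect matchings are regarded as sets of edges. *)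

theory Defs
  imports "HOL-Probability.Probability"
begin

text \<open>A graph is given by a vertex set V and a set E of two-element subsets of V.\<close>

definition finite_simple_graph :: "'a set \<Rightarrow> 'a set set \<Rightarrow> bool" where
  "finite_simple_graph V E \<longleftrightarrow> finite V \<and> E \<subseteq> {e. e \<subseteq> V \<and> card e = 2}"

definition neighbours :: "'a set set \<Rightarrow> 'a \<Rightarrow> 'a set" where
  "neighbours E v = {u. {v, u} \<in> E}"

definition regular_graph :: "nat \<Rightarrow> 'a set \<Rightarrow> 'a set set \<Rightarrow> bool" where
  "regular_graph d V E \<longleftrightarrow> (\<forall>v\<in>V. card (neighbours E v) = d)"

definition robust_neighbourhood :: "real \<Rightarrow> 'a set \<Rightarrow> 'a set set \<Rightarrow> 'a set \<Rightarrow> 'a set" where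
  "robust_neighbourhood \<nu> V E S =
     {v \<in> V. real (card (neighbours E v \<inter> S)) \<ge> \<nu> * real (card V)}"

definition robust_expander :: "real \<Rightarrow> real \<Rightarrow> 'a set \<Rightarrow> 'a set set \<Rightarrow> bool" where
  "robust_expander \<nu> \<tau> V E \<longleftrightarrow>
     (\<forall>S. S \<subseteq> V \<and> \<tau> * real (card V) \<le> real (card S)
            \<and> real (card S) \<le> (1 - \<tau>) * real (card V) \<longrightarrow>
          real (card (robust_neighbourhood \<nu> V E S)) \<ge> real (card S) + \<nu> * real (card V))"

definition perfect_matching :: "'a set \<Rightarrow> 'a set set \<Rightarrow> 'a set set \<Rightarrow> bool" where
  "perfect_matching V E M \<longleftrightarrow> M \<subseteq> E \<and> (\<forall>v\<in>V. \<exists>!e. e \<in> M \<and> v \<in> e)"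

text \<open>
  For a graph without perfect matchings this is the null measure rather than a
  probability measure, so every event then has measure 0.
\<close>

definition random_perfect_matching :: "'a set \<Rightarrow> 'a set set \<Rightarrow> 'a set set measure" where
  "random_perfect_matching V E = uniform_count_measure {M. perfect_matching V E M}"

end

theory Submission
  imports Defs "HOL-Combinatorics.Permutations"
begin

text \<open>
  Fix a vertex \<open>v\<close> and consider the near-perfect matchings missing \<open>v\<close> and one further vertex,
  the hole \<open>y\<close>. Choosing a random neighbour \<open>z\<close> of the hole, matching \<open>y\<close> with \<open>z\<close> and
  making the former partner of \<open>z\<close> the new hole is a reversible random walk with uniform stationary
  distribution. In boundedly many steps it rarely meets a pair that it has already changed, so the
  hole essentially performs the walk ``go to a random neighbour, then to its partner'' with a fixed
  matching. For any fixed matching this walk mixes in boundedly many steps: as long as the variance of a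
  function hardly drops under averaging, robust expansion forces nearly all its values into a short
  interval, and because \<open>d \<ge> \<delta> n\<close> and \<open>\<tau> = \<delta> / 8\<close> the next averaging
  halves its oscillation. The number of near-perfect matchings with hole \<open>y\<close> is \<open>1 / d\<close> times
  the number of those in which the hole is adjacent to the partner of \<open>y\<close>; by stationarity
  and mixing it is therefore asymptotically independent of \<open>y\<close>. For \<open>y\<close> adjacent to \<open>v\<close> these
  matchings correspond to the perfect matchings containing the edge \<open>v y\<close>, so all \<open>d\<close> edges at \<open>v\<close> are
  asymptotically equally likely.
\<close>

section \<open>Averaging over neighbourhoods and the loss of variance\<close>

locale regular_simple_graph =
  fixes V :: "'a set" and E :: "'a set set" and d :: nat
  assumes graph: "finite_simple_graph V E"
    and regular: "regular_graph d V E"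
    and d_pos: "d > 0"
begin

abbreviation N :: "'a \<Rightarrow> 'a set" where "N \<equiv> neighbours E"
abbreviation n :: nat where "n \<equiv> card V"

lemma finite_V [simp]: "finite V"
  using graph by (simp add: finite_simple_graph_def)

lemma N_sub: "N x \<subseteq> V"
  using graph by (auto simp: finite_simple_graph_def neighbours_def)

lemma N_in_V: "z \<in> N x \<Longrightarrow> z \<in> V"
  using N_sub by auto

lemma finite_N [simp]: "finite (N x)"
  using N_sub finite_V finite_subset by blast

lemma N_sym: "z \<in> N x \<longleftrightarrow> x \<in> N z"
  by (simp add: neighbours_def insert_commute)

lemma N_irrefl [simp]: "x \<notin> N x"
  using graph by (auto simp: finite_simple_graph_def neighbours_def)

lemma card_N: "x \<in> V \<Longrightarrow> card (N x) = d"
  using regular by (simp add: regular_graph_def)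

lemma sum_over_N: "(\<Sum>x\<in>V. \<Sum>z\<in>N x. f z) = real d * (\<Sum>z\<in>V. f z)"
proof -
  have "(\<Sum>x\<in>V. \<Sum>z\<in>N x. f z) = (\<Sum>x\<in>V. \<Sum>z | z \<in> V \<and> z \<in> N x. f z)"
    by (intro sum.cong refl) (use N_in_V in auto)
  also have "\<dots> = (\<Sum>z\<in>V. \<Sum>x | x \<in> V \<and> z \<in> N x. f z)"
    by (rule sum.swap_restrict) auto
  also have "\<dots> = (\<Sum>z\<in>V. real d * f z)"
  proof (intro sum.cong refl)
    fix z assume z: "z \<in> V"
    have "{x. x \<in> V \<and> z \<in> N x} = N z" using N_in_V N_sym by blast
    then show "(\<Sum>x | x \<in> V \<and> z \<in> N x. f z) = real d * f z"
      using card_N[OF z] by simp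
  qed
  finally show ?thesis by (simp add: sum_distrib_left)
qed

definition avg :: "('a \<Rightarrow> real) \<Rightarrow> 'a \<Rightarrow> real" where
  "avg f x = (\<Sum>z\<in>N x. f z) / real d"

lemma avg_le:
  assumes "x \<in> V" "\<And>z. z \<in> N x \<Longrightarrow> f z \<le> c"
  shows "avg f x \<le> c"
proof -
  have "(\<Sum>z\<in>N x. f z) \<le> (\<Sum>z\<in>N x. c)" by (intro sum_mono assms)
  then show ?thesis using d_pos card_N[OF assms(1)]
    by (simp add: avg_def divide_le_eq mult.commute)
qed

lemma avg_ge:
  assumes "x \<in> V" "\<And>z. z \<in> N x \<Longrightarrow> c \<le> f z"
  shows "c \<le> avg f x"
proof -
  have "(\<Sum>z\<in>N x. c) \<le> (\<Sum>z\<in>N x. f z)" by (intro sum_mono assms)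
  then show ?thesis using d_pos card_N[OF assms(1)]
    by (simp add: avg_def le_divide_eq mult.commute)
qed

lemma sum_avg: "(\<Sum>x\<in>V. avg f x) = (\<Sum>x\<in>V. f x)"
  using d_pos by (simp add: avg_def sum_over_N flip: sum_divide_distrib)

text \<open>At each \<open>x\<close> the mean of \<open>(f z - c)^2\<close> over the neighbours
  splits into their variance and the squared distance of their mean from \<open>c\<close>;
  \<open>sum_over_N\<close> adds this up over \<open>V\<close>.\<close>

lemma sum_square_avg:
  "(\<Sum>x\<in>V. (f x - c)\<^sup>2) - (\<Sum>x\<in>V. (avg f x - c)\<^sup>2)
     = (\<Sum>x\<in>V. (\<Sum>z\<in>N x. (f z - avg f x)\<^sup>2) / real d)"
proof -
  have *: "(\<Sum>z\<in>N x. (f z - c)\<^sup>2) / real d = (\<Sum>z\<in>N x. (f z - avg f x)\<^sup>2) / real d + (avg f x - c)\<^sup>2"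
    if x: "x \<in> V" for x
  proof -
    let ?a = "avg f x"
    have s: "(\<Sum>z\<in>N x. f z) = real d * ?a" using d_pos by (simp add: avg_def)
    have "(\<Sum>z\<in>N x. (f z - c)\<^sup>2) = (\<Sum>z\<in>N x. (f z - ?a)\<^sup>2 + (2 * (?a - c)) * f z - (2 * (?a - c)) * ?a + (?a - c)\<^sup>2)"
      by (intro sum.cong refl) (simp add: power2_eq_square algebra_simps)
    also have "\<dots> = (\<Sum>z\<in>N x. (f z - ?a)\<^sup>2) + real d * (?a - c)\<^sup>2"
      using card_N[OF x] by (simp add: sum.distrib sum_subtractf s flip: sum_distrib_left)
    finally show ?thesis using d_pos by (simp add: field_simps)
  qed
  have "(\<Sum>x\<in>V. (f x - c)\<^sup>2) = (\<Sum>x\<in>V. \<Sum>z\<in>N x. (f z - c)\<^sup>2) / real d"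
    using d_pos by (simp add: sum_over_N)
  also have "\<dots> = (\<Sum>x\<in>V. (\<Sum>z\<in>N x. (f z - avg f x)\<^sup>2) / real d + (avg f x - c)\<^sup>2)"
    unfolding sum_divide_distrib[of _ V] by (intro sum.cong refl *)
  finally show ?thesis by (simp add: sum.distrib)
qed

text \<open>A vertex in both robust neighbourhoods has \<open>\<nu> * n\<close> neighbours on each
  side of the gap from \<open>s\<close> to \<open>t\<close>, and its average is at least
  \<open>(t - s) / 2\<close> away from all values on one side. As \<open>d\<close> is at most
  \<open>n\<close>, its local variance is at least \<open>\<nu> * ((t - s) / 2)^2\<close>; the
  number of such vertices supplies the second factor \<open>\<nu>\<close>.\<close>

lemma sum_square_avg_drop:
  assumes \<nu>: "\<nu> > 0" and "s < t"
    and S: "\<And>x. x \<in> S \<Longrightarrow> f x \<le> s" and T: "\<And>x. x \<in> T \<Longrightarrow> t \<le> f x"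
    and many: "real (card (robust_neighbourhood \<nu> V E S \<inter> robust_neighbourhood \<nu> V E T)) \<ge> \<nu> * real n"
  shows "(\<Sum>x\<in>V. (avg f x - c)\<^sup>2) \<le> (\<Sum>x\<in>V. (f x - c)\<^sup>2) - \<nu>\<^sup>2 * ((t - s) / 2)\<^sup>2 * real n"
proof -
  let ?W = "robust_neighbourhood \<nu> V E S \<inter> robust_neighbourhood \<nu> V E T"
  let ?q = "((t - s) / 2)\<^sup>2"
  have WV: "?W \<subseteq> V" by (auto simp: robust_neighbourhood_def)
  have W: "\<nu> * ?q \<le> (\<Sum>z\<in>N x. (f z - avg f x)\<^sup>2) / real d" if x: "x \<in> ?W" for x
  proof -
    have xV: "x \<in> V" using x WV by auto
    have dn: "d \<le> n" using card_N[OF xV] N_sub[of x] by (metis card_mono finite_V)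
    have "\<exists>A. \<nu> * real n \<le> real (card (N x \<inter> A)) \<and> (\<forall>z\<in>A. ?q \<le> (f z - avg f x)\<^sup>2)"
    proof (cases "avg f x \<le> (s + t) / 2")
      case True
      have "?q \<le> (f z - avg f x)\<^sup>2" if "z \<in> T" for z
        using T[OF that] True \<open>s < t\<close> by (intro power_mono) (simp_all add: field_simps)
      then show ?thesis using x by (intro exI[of _ T]) (auto simp: robust_neighbourhood_def)
    next
      case False
      have "?q \<le> (avg f x - f z)\<^sup>2" if "z \<in> S" for z
        using S[OF that] False \<open>s < t\<close> by (intro power_mono) (simp_all add: field_simps)
      then show ?thesis using x
        by (intro exI[of _ S]) (auto simp: robust_neighbourhood_def power2_commute)
    qed
    then obtain A where A: "\<nu> * real n \<le> real (card (N x \<inter> A))"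
      "\<forall>z\<in>A. ?q \<le> (f z - avg f x)\<^sup>2" by auto
    have "\<nu> * ?q * real d \<le> \<nu> * ?q * real n"
      using dn \<nu> by (intro mult_left_mono) auto
    also have "\<dots> \<le> real (card (N x \<inter> A)) * ?q"
      using mult_right_mono[OF A(1), of ?q] by (simp add: mult_ac)
    also have "\<dots> = (\<Sum>z\<in>N x \<inter> A. ?q)" by simp
    also have "\<dots> \<le> (\<Sum>z\<in>N x \<inter> A. (f z - avg f x)\<^sup>2)" using A(2) by (intro sum_mono) auto
    also have "\<dots> \<le> (\<Sum>z\<in>N x. (f z - avg f x)\<^sup>2)" by (intro sum_mono2) auto
    finally show ?thesis using d_pos by (simp add: le_divide_eq)
  qed
  have "\<nu>\<^sup>2 * ?q * real n = (\<nu> * real n) * (\<nu> * ?q)" by (simp add: power2_eq_square)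
  also have "\<dots> \<le> real (card ?W) * (\<nu> * ?q)" using many \<nu> by (intro mult_right_mono) auto
  also have "\<dots> = (\<Sum>x\<in>?W. \<nu> * ?q)" by simp
  also have "\<dots> \<le> (\<Sum>x\<in>?W. (\<Sum>z\<in>N x. (f z - avg f x)\<^sup>2) / real d)" by (intro sum_mono W)
  also have "\<dots> \<le> (\<Sum>x\<in>V. (\<Sum>z\<in>N x. (f z - avg f x)\<^sup>2) / real d)"
    using WV by (intro sum_mono2) (auto intro!: divide_nonneg_nonneg sum_nonneg)
  finally show ?thesis unfolding sum_square_avg[symmetric, of f c] by simp
qed

end

section \<open>One averaging step under robust expansion\<close>

locale dense_expander = regular_simple_graph +
  fixes \<nu> \<delta> :: real
  assumes dense: "\<delta> * real n \<le> real d" and \<delta>_pos: "\<delta> > 0" and \<nu>_pos: "\<nu> > 0"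
    and nonempty: "V \<noteq> {}"
    and expander: "robust_expander \<nu> (\<delta> / 8) V E"
begin

lemma n_pos: "n > 0"
  using nonempty by (simp add: card_gt_0_iff)

text \<open>Each robust neighbourhood exceeds its set by \<open>\<nu> * n\<close>, so the two sizes
  add up to at least \<open>(1 + \<nu>) * n\<close>, which forces the overlap. Disjointness and the
  lower bound on one set keep the other within the size range of the expander property.\<close>

lemma robust_neighbourhoods_meet:
  assumes "S \<subseteq> V" "T \<subseteq> V" "S \<inter> T = {}"
    and "\<delta> / 8 * real n \<le> real (card S)" "\<delta> / 8 * real n \<le> real (card T)"
    and "real n - \<nu> * real n \<le> real (card S) + real (card T)"
  shows "\<nu> * real n \<le> real (card (robust_neighbourhood \<nu> V E S \<inter> robust_neighbourhood \<nu> V E T))"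
proof -
  let ?A = "robust_neighbourhood \<nu> V E S" and ?B = "robust_neighbourhood \<nu> V E T"
  have fin: "finite S" "finite T" using assms finite_subset[OF _ finite_V] by auto
  have "card S + card T \<le> n"
    using card_Un_disjoint[OF fin assms(3)] card_mono[OF finite_V, of "S \<union> T"] assms by simp
  then have le: "real (card S) + real (card T) \<le> real n" by linarith
  have A: "real (card ?A) \<ge> real (card S) + \<nu> * real n"
    using expander assms le unfolding robust_expander_def by (auto simp: algebra_simps)
  have B: "real (card ?B) \<ge> real (card T) + \<nu> * real n"
    using expander assms le unfolding robust_expander_def by (auto simp: algebra_simps)
  have AB: "?A \<subseteq> V" "?B \<subseteq> V" by (auto simp: robust_neighbourhood_def)
  have fAB: "finite ?A" "finite ?B" using AB finite_subset[OF _ finite_V] by auto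
  have "card (?A \<union> ?B) \<le> n" using AB by (intro card_mono) auto
  then have "real (card ?A) + real (card ?B) \<le> real n + real (card (?A \<inter> ?B))"
    using card_Un_Int[OF fAB] by linarith
  then show ?thesis using A B assms(6) by linarith
qed

text \<open>At most \<open>\<delta> * n / 8\<close>, hence at most \<open>d / 8\<close>, neighbours
  are exceptional, and each adds at most \<open>D\<close> to the sum.\<close>

lemma avg_few_exceptions_le:
  assumes x: "x \<in> V" and f: "\<And>z. z \<in> V \<Longrightarrow> f z \<le> c + D" and "D \<ge> 0"
    and few: "real (card {z\<in>V. f z > c}) \<le> \<delta> / 8 * real n"
  shows "avg f x \<le> c + D / 8"
proof -
  have "(\<Sum>z\<in>N x. f z) \<le> (\<Sum>z\<in>N x. c + (if f z > c then D else 0))"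
    using f N_in_V by (intro sum_mono) auto
  also have "\<dots> = real d * c + (\<Sum>z\<in>N x. if f z > c then D else 0)"
    using card_N[OF x] by (simp add: sum.distrib)
  also have "(\<Sum>z\<in>N x. if f z > c then D else 0) = (\<Sum>z\<in>N x \<inter> {z. f z > c}. D)"
    by (subst sum.inter_restrict) auto
  also have "\<dots> = real (card (N x \<inter> {z. f z > c})) * D" by simp
  also have "\<dots> \<le> real (card {z\<in>V. f z > c}) * D"
    using \<open>D \<ge> 0\<close> N_in_V by (intro mult_right_mono of_nat_mono card_mono) auto
  also have "\<dots> \<le> (real d / 8) * D"
    using few dense \<open>D \<ge> 0\<close> by (intro mult_right_mono) auto
  finally have "(\<Sum>z\<in>N x. f z) \<le> real d * (c + D / 8)" by (simp add: algebra_simps)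
  then show ?thesis using d_pos by (simp add: avg_def divide_le_eq mult.commute)
qed

lemma avg_few_exceptions_ge:
  assumes x: "x \<in> V" and f: "\<And>z. z \<in> V \<Longrightarrow> c - D \<le> f z" and "D \<ge> 0"
    and few: "real (card {z\<in>V. f z < c}) \<le> \<delta> / 8 * real n"
  shows "c - D / 8 \<le> avg f x"
proof -
  have "avg (\<lambda>z. - f z) x \<le> - c + D / 8"
    by (rule avg_few_exceptions_le[OF x]) (use f few \<open>D \<ge> 0\<close> in force)+
  then show ?thesis by (simp add: avg_def sum_negf)
qed

text \<open>
  Cut the range of \<open>f\<close> into \<open>m\<close> bands. If some band between two level sets of size at least
  \<open>\<delta> n / 8\<close> contains few vertices, then many neighbourhoods meet both level sets
  substantially, and averaging loses variance. Otherwise there are at most \<open>1 / \<nu>\<close> such bands, so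
  \<open>f\<close> is concentrated on a short interval up to fewer than \<open>\<delta> n / 4\<close> vertices, which
  are at most a quarter of any neighbourhood.
\<close>
lemma avg_step:
  fixes m :: nat
  assumes m: "real m \<ge> 4 * (1 / \<nu> + 2)" and "lo < hi"
    and f: "\<And>x. x \<in> V \<Longrightarrow> lo \<le> f x \<and> f x \<le> hi"
  shows "(\<Sum>x\<in>V. (avg f x - lo)\<^sup>2) \<le> (\<Sum>x\<in>V. (f x - lo)\<^sup>2) - \<nu>\<^sup>2 * ((hi - lo) / m / 2)\<^sup>2 * real n
    \<or> (\<exists>lo' hi'. hi' - lo' \<le> (hi - lo) / 2 \<and> (\<forall>x\<in>V. lo' \<le> avg f x \<and> avg f x \<le> hi'))"
proof -
  define w where "w = (hi - lo) / m"
  have m0: "real m > 0" using m \<nu>_pos by (smt (verit) divide_pos_pos)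
  have w: "w > 0" "real m * w = hi - lo" using m0 \<open>lo < hi\<close> by (simp_all add: w_def)
  define t where "t i = lo + real i * w" for i :: nat
  have t_mono: "t i \<le> t j" if "i \<le> j" for i j
    using that w by (simp add: t_def)
  define L where "L i = {x\<in>V. f x < t i}" for i
  define U where "U i = {x\<in>V. t i \<le> f x}" for i
  let ?k = "\<delta> / 8 * real n"
  have k0: "?k > 0" using \<delta>_pos n_pos by simp
  \<comment> \<open>\<open>L\<close> uses a strict inequality and the value \<open>hi\<close>, which
    is \<open>t m\<close>, may be attained; one more level is needed to exhaust
    \<open>V\<close>.\<close>
  have LSuc: "L (Suc m) = V"
    using f w by (auto simp: L_def t_def algebra_simps) (smt (verit))
  have L0: "L 0 = {}" using f by (force simp: L_def t_def)
  obtain x0 where "x0 \<in> V" using nonempty by auto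
  then have "d \<le> n" using card_N[of x0] N_sub[of x0] by (metis card_mono finite_V)
  then have "\<delta> * real n \<le> real n" using dense by linarith
  then have kn: "?k \<le> real n" using k0 by linarith
  define a where "a = (LEAST i. ?k \<le> real (card (L i)))"
  have ex: "?k \<le> real (card (L (Suc m)))" using kn LSuc by simp
  have a: "?k \<le> real (card (L a))" unfolding a_def by (rule LeastI[of _ "Suc m"]) (rule ex)
  have am: "a \<le> Suc m" unfolding a_def by (rule Least_le) (rule ex)
  have "a \<noteq> 0" using a k0 L0 by (metis card.empty of_nat_0 not_less)
  then obtain a' where a': "a = Suc a'" using not0_implies_Suc by blast
  have La': "real (card (L a')) < ?k"
    using not_less_Least[of a' "\<lambda>i. ?k \<le> real (card (L i))"] a' unfolding a_def by simp
  have Um: "U (Suc (Suc m)) = {}"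
    using f w by (auto simp: U_def t_def algebra_simps) (smt (verit))
  \<comment> \<open>The bands \<open>B i\<close> with \<open>a \<le> i\<close> and
    \<open>i < b\<close> have large level sets on both sides; only few vertices lie below
    \<open>t a'\<close> or above \<open>t (Suc b)\<close>.\<close>
  define b where "b = (LEAST i. a \<le> i \<and> real (card (U (Suc i))) < ?k)"
  have exb: "a \<le> Suc m \<and> real (card (U (Suc (Suc m)))) < ?k" using am Um k0 by simp
  have b: "a \<le> b" "real (card (U (Suc b))) < ?k"
    using LeastI[of "\<lambda>i. a \<le> i \<and> real (card (U (Suc i))) < ?k", OF exb] unfolding b_def by auto
  have U_big: "?k \<le> real (card (U (Suc i)))" if "a \<le> i" "i < b" for i
    using not_less_Least[of i "\<lambda>i. a \<le> i \<and> real (card (U (Suc i))) < ?k"] that unfolding b_def by simp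
  have L_big: "?k \<le> real (card (L i))" if "a \<le> i" for i
  proof -
    have "L a \<subseteq> L i" using t_mono[OF that] by (auto simp: L_def)
    then have "card (L a) \<le> card (L i)" by (intro card_mono) (auto simp: L_def)
    then show ?thesis using a by linarith
  qed
  define B where "B i = {x\<in>V. t i \<le> f x \<and> f x < t (Suc i)}" for i
  show ?thesis
  proof (cases "\<exists>i. a \<le> i \<and> i < b \<and> real (card (B i)) \<le> \<nu> * real n")
    case True
    then obtain i where i: "a \<le> i" "i < b" "real (card (B i)) \<le> \<nu> * real n" by auto
    have ti: "t i < t (Suc i)" using w by (simp add: t_def)
    have "V = L i \<union> B i \<union> U (Suc i)" using ti by (auto simp: L_def U_def B_def)
    moreover have "finite (L i)" "finite (B i)" "finite (U (Suc i))" by (auto simp: L_def B_def U_def)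
    moreover have "L i \<inter> B i = {}" "(L i \<union> B i) \<inter> U (Suc i) = {}"
      using ti by (auto simp: L_def U_def B_def)
    ultimately have "n = card (L i) + card (B i) + card (U (Suc i))"
      by (metis card_Un_disjoint finite_UnI)
    then have "real n - \<nu> * real n \<le> real (card (L i)) + real (card (U (Suc i)))"
      using i(3) by linarith
    then have "\<nu> * real n \<le> real (card (robust_neighbourhood \<nu> V E (L i) \<inter> robust_neighbourhood \<nu> V E (U (Suc i))))"
      using L_big[OF i(1)] U_big[OF i(1,2)] ti
      by (intro robust_neighbourhoods_meet) (auto simp: L_def U_def)
    from sum_square_avg_drop[OF \<nu>_pos ti _ _ this, of f lo]
    have "(\<Sum>x\<in>V. (avg f x - lo)\<^sup>2) \<le> (\<Sum>x\<in>V. (f x - lo)\<^sup>2) - \<nu>\<^sup>2 * ((t (Suc i) - t i) / 2)\<^sup>2 * real n"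
      by (auto simp: L_def U_def)
    moreover have "t (Suc i) - t i = w" by (simp add: t_def algebra_simps)
    ultimately show ?thesis by (simp add: w_def)
  next
    case False
    then have big: "\<nu> * real n \<le> real (card (B i))" if "a \<le> i" "i < b" for i
      using that by (meson linear)
    have disj: "B i \<inter> B j = {}" if "i \<noteq> j" for i j
    proof -
      have "Suc i \<le> j \<or> Suc j \<le> i" using that by auto
      then show ?thesis using t_mono[of "Suc i" j] t_mono[of "Suc j" i] by (auto simp: B_def)
    qed
    have "real (b - a) * (\<nu> * real n) = (\<Sum>i\<in>{a..<b}. \<nu> * real n)" by simp
    also have "\<dots> \<le> (\<Sum>i\<in>{a..<b}. real (card (B i)))" using big by (intro sum_mono) auto
    also have "\<dots> = real (card (\<Union>i\<in>{a..<b}. B i))"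
      by (subst card_UN_disjoint) (use disj in \<open>auto simp: B_def\<close>)
    also have "\<dots> \<le> real n" by (intro of_nat_mono card_mono) (auto simp: B_def)
    finally have "real (b - a) * \<nu> \<le> 1" using n_pos by simp
    then have "real (b - a) \<le> 1 / \<nu>" using \<nu>_pos by (simp add: le_divide_eq)
    then have "4 * (real (b - a) + 2) \<le> 4 * (1 / \<nu> + 2)" by (intro mult_left_mono) auto
    then have r: "real (b - a) + 2 \<le> real m / 4" using m by (simp add: mult.commute)
    \<comment> \<open>The two extra bands are the one just below level \<open>a\<close> and band
      \<open>b\<close> itself; \<open>m\<close> is large enough to make the total a quarter of the
      range.\<close>
    have "t (Suc b) - t a' = (real (b - a) + 2) * w"
      using b(1) a' by (simp add: t_def algebra_simps of_nat_diff)
    also have "\<dots> \<le> real m / 4 * w" using r w by (intro mult_right_mono) auto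
    finally have width: "t (Suc b) - t a' \<le> (hi - lo) / 4" using w by simp
    have "t 0 \<le> t (Suc b)" by (rule t_mono) simp
    then have hi: "hi \<le> t (Suc b) + (hi - lo)" by (simp add: t_def)
    have "t a' \<le> t m" using am a' by (intro t_mono) simp
    then have lo: "t a' - (hi - lo) \<le> lo" using w by (simp add: t_def)
    \<comment> \<open>With \<open>D = hi - lo\<close> the exceptions cost an eighth of the range at
      either end; a quarter plus two eighths is the required half.\<close>
    have "avg f x \<le> t (Suc b) + (hi - lo) / 8 \<and> t a' - (hi - lo) / 8 \<le> avg f x" if x: "x \<in> V" for x
    proof
      have "card {z\<in>V. f z > t (Suc b)} \<le> card (U (Suc b))"
        by (intro card_mono) (auto simp: U_def)
      then have "real (card {z\<in>V. f z > t (Suc b)}) \<le> ?k" using b(2) by linarith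
      then show "avg f x \<le> t (Suc b) + (hi - lo) / 8"
        using f hi \<open>lo < hi\<close> by (intro avg_few_exceptions_le[OF x]) force+
      have "real (card {z\<in>V. f z < t a'}) \<le> ?k" using La' by (simp add: L_def)
      then show "t a' - (hi - lo) / 8 \<le> avg f x"
        using f lo \<open>lo < hi\<close> by (intro avg_few_exceptions_ge[OF x]) force+
    qed
    then have "\<forall>x\<in>V. t a' - (hi - lo) / 8 \<le> avg f x \<and> avg f x \<le> t (Suc b) + (hi - lo) / 8" by blast
    moreover have "t (Suc b) + (hi - lo) / 8 - (t a' - (hi - lo) / 8) \<le> (hi - lo) / 2"
      using width by argo
    ultimately show ?thesis by blast
  qed
qed

end

section \<open>Pairings, the walk along a fixed pairing, and the moving hole\<close>

context regular_simple_graph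
begin

text \<open>Perfect matchings of the complete graph on \<open>V\<close>, as fixed-point-free
  involutions. Being the identity outside \<open>V\<close>, they are finite in number and determined
  by their values on \<open>V\<close>.\<close>

definition pairing :: "('a \<Rightarrow> 'a) \<Rightarrow> bool" where
  "pairing \<sigma> \<longleftrightarrow> \<sigma> permutes V \<and> (\<forall>x\<in>V. \<sigma> x \<noteq> x \<and> \<sigma> (\<sigma> x) = x)"

lemma pairing_permutes: "pairing \<sigma> \<Longrightarrow> \<sigma> permutes V"
  by (simp add: pairing_def)

lemma pairing_in_V: "pairing \<sigma> \<Longrightarrow> \<sigma> x \<in> V \<longleftrightarrow> x \<in> V"
  by (simp add: pairing_def permutes_in_image)

lemma pairing_involution: "pairing \<sigma> \<Longrightarrow> \<sigma> (\<sigma> x) = x"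
  by (metis pairing_def permutes_not_in)

lemma pairing_neq: "pairing \<sigma> \<Longrightarrow> x \<in> V \<Longrightarrow> \<sigma> x \<noteq> x"
  by (simp add: pairing_def)

lemma pairingI:
  assumes "\<And>x. x \<in> V \<Longrightarrow> \<sigma> x \<in> V \<and> \<sigma> x \<noteq> x \<and> \<sigma> (\<sigma> x) = x"
    and "\<And>x. x \<notin> V \<Longrightarrow> \<sigma> x = x"
  shows "pairing \<sigma>"
proof -
  have "\<sigma> (\<sigma> x) = x" for x using assms by (cases "x \<in> V") auto
  then have "\<sigma> permutes V"
    unfolding permutes_def using assms(2) by metis
  then show ?thesis using assms by (auto simp: pairing_def)
qed

lemma pairing_eq_iff: "pairing \<sigma> \<Longrightarrow> \<sigma> x = y \<longleftrightarrow> x = \<sigma> y"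
  using pairing_involution by metis

lemma finite_pairings [simp]: "finite {\<sigma>. pairing \<sigma>}"
  by (rule finite_subset[OF _ finite_permutations[OF finite_V]]) (auto simp: pairing_def)

text \<open>The transition operator on functions: its \<open>k\<close>-th iterate at
  \<open>x\<close> is the expectation of \<open>g\<close> after \<open>k\<close> steps from
  \<open>x\<close>.\<close>

definition walk :: "('a \<Rightarrow> 'a) \<Rightarrow> ('a \<Rightarrow> real) \<Rightarrow> 'a \<Rightarrow> real" where
  "walk \<sigma> g = avg (\<lambda>z. g (\<sigma> z))"

lemma sum_pairing: "pairing \<sigma> \<Longrightarrow> (\<Sum>x\<in>V. g (\<sigma> x)) = (\<Sum>x\<in>V. g x)"
  using sum.permute[OF pairing_permutes, of \<sigma> g] by (simp add: comp_def)

lemma walk_bounds: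
  assumes "pairing \<sigma>" "\<forall>x\<in>V. lo \<le> g x \<and> g x \<le> hi"
  shows "\<forall>x\<in>V. lo \<le> (walk \<sigma> ^^ k) g x \<and> (walk \<sigma> ^^ k) g x \<le> hi"
proof (induction k)
  case 0
  then show ?case using assms by simp
next
  case (Suc k)
  then show ?case using pairing_in_V[OF assms(1)] N_in_V
    by (auto simp: walk_def intro!: avg_le avg_ge)
qed

lemma sum_walk: "pairing \<sigma> \<Longrightarrow> (\<Sum>x\<in>V. (walk \<sigma> ^^ k) g x) = (\<Sum>x\<in>V. g x)"
  by (induction k) (simp_all add: walk_def sum_avg sum_pairing)

text \<open>Run both walks with the same neighbours: each step hits \<open>A\<close> with
  probability at most \<open>4 / d\<close>, and a hit costs at most 1 because values stay in the
  unit interval.\<close>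

lemma walk_perturb:
  assumes \<sigma>: "pairing \<sigma>" "pairing \<sigma>'" and A: "\<And>x. x \<notin> A \<Longrightarrow> \<sigma> x = \<sigma>' x" "finite A" "card A \<le> 4"
    and h: "\<forall>x\<in>V. 0 \<le> h x \<and> h x \<le> 1"
  shows "x \<in> V \<Longrightarrow> \<bar>(walk \<sigma> ^^ j) h x - (walk \<sigma>' ^^ j) h x\<bar> \<le> 4 * real j / real d"
proof (induction j arbitrary: x)
  case 0
  then show ?case by simp
next
  case (Suc j)
  let ?g = "(walk \<sigma> ^^ j) h" and ?g' = "(walk \<sigma>' ^^ j) h"
  let ?e = "4 * real j / real d"
  have e: "\<bar>?g (\<sigma> z) - ?g' (\<sigma>' z)\<bar> \<le> (if z \<in> A then 1 else 0) + ?e" if z: "z \<in> N x" for z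
  proof (cases "z \<in> A")
    case True
    have "\<sigma> z \<in> V" "\<sigma>' z \<in> V" using N_in_V[OF z] \<sigma> by (simp_all add: pairing_in_V)
    then have "0 \<le> ?g (\<sigma> z)" "?g (\<sigma> z) \<le> 1" "0 \<le> ?g' (\<sigma>' z)" "?g' (\<sigma>' z) \<le> 1"
      using walk_bounds[OF \<sigma>(1) h, of j] walk_bounds[OF \<sigma>(2) h, of j] by auto
    then have "\<bar>?g (\<sigma> z) - ?g' (\<sigma>' z)\<bar> \<le> 1" by linarith
    then show ?thesis using True by (simp add: add_increasing2)
  next
    case False
    have "\<sigma> z \<in> V" using N_in_V[OF z] \<sigma> by (simp add: pairing_in_V)
    then show ?thesis using Suc.IH[of "\<sigma> z"] A(1)[OF False] False by simp
  qed
  have "\<bar>(\<Sum>z\<in>N x. ?g (\<sigma> z)) - (\<Sum>z\<in>N x. ?g' (\<sigma>' z))\<bar> \<le> (\<Sum>z\<in>N x. \<bar>?g (\<sigma> z) - ?g' (\<sigma>' z)\<bar>)"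
    unfolding sum_subtractf[symmetric] by (rule sum_abs)
  also have "\<dots> \<le> (\<Sum>z\<in>N x. (if z \<in> A then 1 else 0) + ?e)" by (intro sum_mono e)
  also have "\<dots> = real (card (N x \<inter> A)) + real d * ?e"
    using card_N[OF Suc.prems] by (simp add: sum.distrib flip: sum.inter_restrict)
  also have "card (N x \<inter> A) \<le> 4" using card_mono[OF A(2), of "N x \<inter> A"] A(3) by simp
  also have "real 4 + real d * ?e = 4 * real (Suc j)" using d_pos by (simp add: field_simps)
  finally have "\<bar>(\<Sum>z\<in>N x. ?g (\<sigma> z)) - (\<Sum>z\<in>N x. ?g' (\<sigma>' z))\<bar> / real d \<le> 4 * real (Suc j) / real d"
    by (simp add: divide_right_mono)
  then show ?case
    by (simp add: walk_def[of _ "(walk _ ^^ j) h"] avg_def flip: diff_divide_distrib)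
qed

text \<open>
  The pair of \<open>v\<close> need not be an edge: \<open>\<sigma> v\<close> is the hole of a near-perfect matching that
  misses \<open>v\<close>. Rematching the hole with its neighbour \<open>z\<close> moves the hole to \<open>\<sigma> z\<close>
  and changes nothing if \<open>z = v\<close>.
\<close>
definition rematch :: "'a \<Rightarrow> ('a \<Rightarrow> 'a) \<Rightarrow> 'a \<Rightarrow> 'a \<Rightarrow> 'a" where
  "rematch v \<sigma> z = \<sigma>(v := \<sigma> z, \<sigma> z := v, \<sigma> v := z, z := \<sigma> v)"

text \<open>If \<open>z = v\<close>, the overlapping updates agree; otherwise the four points are
  distinct, so the cases can be tested in any order.\<close>

lemma rematch_apply:
  assumes "pairing \<sigma>" "v \<in> V" "z \<in> N (\<sigma> v)"
  shows "rematch v \<sigma> z x =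
    (if x = v then \<sigma> z else if x = \<sigma> z then v else if x = \<sigma> v then z else if x = z then \<sigma> v else \<sigma> x)"
  using assms pairing_neq[of \<sigma> v] pairing_neq[of \<sigma> z] pairing_involution[of \<sigma> v]
    pairing_involution[of \<sigma> z] N_in_V[OF assms(3)] N_irrefl[of "\<sigma> v"]
  by (auto simp: rematch_def)

lemma rematch_hole: "pairing \<sigma> \<Longrightarrow> v \<in> V \<Longrightarrow> z \<in> N (\<sigma> v) \<Longrightarrow> rematch v \<sigma> z v = \<sigma> z"
  by (simp add: rematch_apply)

lemma rematch_pairing:
  assumes "pairing \<sigma>" "v \<in> V" "z \<in> N (\<sigma> v)"
  shows "pairing (rematch v \<sigma> z)"
proof -
  have z: "z \<in> V" "z \<noteq> \<sigma> v" using N_in_V[OF assms(3)] assms(3) by auto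
  show ?thesis
  proof (rule pairingI)
    fix x assume "x \<in> V"
    then show "rematch v \<sigma> z x \<in> V \<and> rematch v \<sigma> z x \<noteq> x \<and> rematch v \<sigma> z (rematch v \<sigma> z x) = x"
      unfolding rematch_apply[OF assms]
      using pairing_neq[OF assms(1)] z assms(1,2) pairing_in_V[OF assms(1)]
        pairing_involution[OF assms(1)]
      by (smt (verit))
  next
    fix x assume "x \<notin> V"
    then show "rematch v \<sigma> z x = x"
      unfolding rematch_apply[OF assms]
      using z assms(1,2) pairing_in_V[OF assms(1)] permutes_not_in[OF pairing_permutes[OF assms(1)]]
      by metis
  qed
qed

definition move :: "'a \<Rightarrow> (('a \<Rightarrow> 'a) \<Rightarrow> real) \<Rightarrow> ('a \<Rightarrow> 'a) \<Rightarrow> real" where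
  "move v F \<sigma> = avg (\<lambda>z. F (rematch v \<sigma> z)) (\<sigma> v)"

lemma move_bounds:
  assumes "v \<in> V" "\<And>\<sigma>. pairing \<sigma> \<Longrightarrow> 0 \<le> F \<sigma> \<and> F \<sigma> \<le> 1"
  shows "pairing \<sigma> \<Longrightarrow> 0 \<le> (move v ^^ k) F \<sigma> \<and> (move v ^^ k) F \<sigma> \<le> 1"
proof (induction k arbitrary: \<sigma>)
  case 0
  then show ?case using assms by simp
next
  case (Suc k)
  then show ?case using pairing_in_V[OF Suc.prems] rematch_pairing[OF Suc.prems assms(1)] assms(1)
    by (auto simp: move_def intro!: avg_le avg_ge)
qed

lemma abs_avg_diff_le:
  assumes "x \<in> V" "\<And>z. z \<in> N x \<Longrightarrow> \<bar>f z - g z\<bar> \<le> c"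
  shows "\<bar>avg f x - avg g x\<bar> \<le> c"
proof -
  have eq: "avg f x - avg g x = avg (\<lambda>z. f z - g z) x"
    by (simp add: avg_def sum_subtractf diff_divide_distrib)
  have "avg (\<lambda>z. f z - g z) x \<le> c" "- c \<le> avg (\<lambda>z. f z - g z) x"
    by (intro avg_le avg_ge; use assms in \<open>force simp: abs_le_iff\<close>)+
  then show ?thesis unfolding eq by linarith
qed

text \<open>One rematching alters \<open>\<sigma>\<close> on at most four vertices, so keeping the
  old pairing for the remaining \<open>k\<close> steps costs at most \<open>4 * k / d\<close> by
  \<open>walk_perturb\<close>. Summed over the steps this is quadratic.\<close>

lemma move_walk:
  assumes v: "v \<in> V" and h: "\<forall>x\<in>V. 0 \<le> h x \<and> h x \<le> 1"
  shows "pairing \<sigma> \<Longrightarrow> \<bar>(move v ^^ k) (\<lambda>\<tau>. h (\<tau> v)) \<sigma> - (walk \<sigma> ^^ k) h (\<sigma> v)\<bar> \<le> 4 * (real k)\<^sup>2 / real d"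
proof (induction k arbitrary: \<sigma>)
  case 0
  then show ?case by simp
next
  case (Suc k)
  note \<sigma> = \<open>pairing \<sigma>\<close>
  have "\<bar>(move v ^^ k) (\<lambda>\<tau>. h (\<tau> v)) (rematch v \<sigma> z) - (walk \<sigma> ^^ k) h (\<sigma> z)\<bar> \<le> 4 * (real (Suc k))\<^sup>2 / real d"
    if z: "z \<in> N (\<sigma> v)" for z
  proof -
    let ?r = "rematch v \<sigma> z"
    have r: "pairing ?r" by (rule rematch_pairing[OF \<sigma> v z])
    have "\<bar>(walk ?r ^^ k) h (\<sigma> z) - (walk \<sigma> ^^ k) h (\<sigma> z)\<bar> \<le> 4 * real k / real d"
    proof (rule walk_perturb[OF r \<sigma> _ _ _ h])
      show "?r x = \<sigma> x" if "x \<notin> {v, \<sigma> z, \<sigma> v, z}" for x using that by (simp add: rematch_def)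
      show "card {v, \<sigma> z, \<sigma> v, z} \<le> 4" by (simp add: card_insert_if)
      show "\<sigma> z \<in> V" using N_in_V[OF z] pairing_in_V[OF \<sigma>] by simp
    qed simp
    moreover have "\<bar>(move v ^^ k) (\<lambda>\<tau>. h (\<tau> v)) ?r - (walk ?r ^^ k) h (\<sigma> z)\<bar> \<le> 4 * (real k)\<^sup>2 / real d"
      using Suc.IH[OF r] rematch_hole[OF \<sigma> v z] by simp
    moreover have "4 * (real k)\<^sup>2 / real d + 4 * real k / real d \<le> 4 * (real (Suc k))\<^sup>2 / real d"
      unfolding add_divide_distrib[symmetric]
      by (intro divide_right_mono) (simp_all add: power2_eq_square algebra_simps)
    ultimately show ?thesis by linarith
  qed
  then show ?case
    unfolding funpow.simps comp_def move_def[of v "(move v ^^ k) _"] walk_def[of \<sigma> "(walk \<sigma> ^^ k) _"]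
    using v pairing_in_V[OF \<sigma>] by (intro abs_avg_diff_le) auto
qed

text \<open>The partner of \<open>y\<close> can change only if the chosen \<open>z\<close> is
  \<open>y\<close> or its partner, which has probability at most \<open>2 / d\<close> per step.
  Otherwise \<open>y\<close> also stays different from the hole, so the induction continues.\<close>

lemma move_adjacent:
  assumes v: "v \<in> V" and "y \<noteq> v"
  shows "pairing \<sigma> \<Longrightarrow> y \<noteq> \<sigma> v \<Longrightarrow>
    \<bar>(move v ^^ k) (\<lambda>\<tau>. of_bool (\<tau> v \<in> N (\<tau> y))) \<sigma> - (move v ^^ k) (\<lambda>\<tau>. of_bool (\<tau> v \<in> N (\<sigma> y))) \<sigma>\<bar>
      \<le> 2 * real k / real d"
proof (induction k arbitrary: \<sigma>)
  case 0
  then show ?case by simp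
next
  case (Suc k)
  note \<sigma> = \<open>pairing \<sigma>\<close>
  let ?F = "(move v ^^ k) (\<lambda>\<tau>. of_bool (\<tau> v \<in> N (\<tau> y)))"
  let ?H = "(move v ^^ k) (\<lambda>\<tau>. of_bool (\<tau> v \<in> N (\<sigma> y)))"
  define A where "A = {y, \<sigma> y}"
  let ?e = "2 * real k / real d"
  have e: "\<bar>?F (rematch v \<sigma> z) - ?H (rematch v \<sigma> z)\<bar> \<le> (if z \<in> A then 1 else 0) + ?e"
    if z: "z \<in> N (\<sigma> v)" for z
  proof -
    let ?r = "rematch v \<sigma> z"
    have r: "pairing ?r" by (rule rematch_pairing[OF \<sigma> v z])
    show ?thesis
    proof (cases "z \<in> A")
      case True
      have "0 \<le> ?F ?r \<and> ?F ?r \<le> 1" "0 \<le> ?H ?r \<and> ?H ?r \<le> 1"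
        by (rule move_bounds[OF v _ r], simp)+
      then have "\<bar>?F ?r - ?H ?r\<bar> \<le> 1" by linarith
      then show ?thesis using True by (simp add: add_increasing2)
    next
      case False
      have y: "y \<noteq> \<sigma> z" using False A_def pairing_involution[OF \<sigma>] by auto
      then have "?r y = \<sigma> y" using False A_def \<open>y \<noteq> v\<close> Suc.prems(2) by (auto simp: rematch_def)
      moreover have "y \<noteq> ?r v" using y rematch_hole[OF \<sigma> v z] by simp
      ultimately show ?thesis using Suc.IH[OF r] False by simp
    qed
  qed
  have \<sigma>v: "\<sigma> v \<in> V" using v pairing_in_V[OF \<sigma>] by simp
  have "\<bar>(\<Sum>z\<in>N (\<sigma> v). ?F (rematch v \<sigma> z)) - (\<Sum>z\<in>N (\<sigma> v). ?H (rematch v \<sigma> z))\<bar>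
      \<le> (\<Sum>z\<in>N (\<sigma> v). \<bar>?F (rematch v \<sigma> z) - ?H (rematch v \<sigma> z)\<bar>)"
    unfolding sum_subtractf[symmetric] by (rule sum_abs)
  also have "\<dots> \<le> (\<Sum>z\<in>N (\<sigma> v). (if z \<in> A then 1 else 0) + ?e)" by (intro sum_mono e)
  also have "\<dots> = real (card (N (\<sigma> v) \<inter> A)) + real d * ?e"
    using card_N[OF \<sigma>v] by (simp add: sum.distrib flip: sum.inter_restrict)
  also have "card (N (\<sigma> v) \<inter> A) \<le> 2"
    using card_mono[of A "N (\<sigma> v) \<inter> A"] unfolding A_def by (simp add: card_insert_if split: if_splits)
  also have "real 2 + real d * ?e = 2 * real (Suc k)" using d_pos by (simp add: field_simps)
  finally have "\<bar>(\<Sum>z\<in>N (\<sigma> v). ?F (rematch v \<sigma> z)) - (\<Sum>z\<in>N (\<sigma> v). ?H (rematch v \<sigma> z))\<bar> / real d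
      \<le> 2 * real (Suc k) / real d"
    by (simp add: divide_right_mono)
  then show ?case
    by (simp add: move_def[of v "(move v ^^ k) _"] avg_def flip: diff_divide_distrib)
qed

text \<open>Turns probability into existence: a nonzero expectation has a nonzero summand at each
  step, and following these gives a path of moves along which \<open>I\<close> persists.\<close>

lemma move_positive_reachable:
  assumes v: "v \<in> V" and step: "\<And>\<sigma> z. I \<sigma> \<Longrightarrow> z \<in> N (\<sigma> v) \<Longrightarrow> I (rematch v \<sigma> z)"
  shows "I \<sigma> \<Longrightarrow> (move v ^^ k) F \<sigma> \<noteq> 0 \<Longrightarrow> \<exists>\<tau>. I \<tau> \<and> F \<tau> \<noteq> 0"
proof (induction k arbitrary: \<sigma>)
  case 0
  then show ?case by auto
next
  case (Suc k)
  have "(\<Sum>z\<in>N (\<sigma> v). (move v ^^ k) F (rematch v \<sigma> z)) \<noteq> 0"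
    using Suc.prems(2) by (auto simp: move_def[of v "(move v ^^ k) F"] avg_def)
  then obtain z where "z \<in> N (\<sigma> v)" "(move v ^^ k) F (rematch v \<sigma> z) \<noteq> 0"
    by (rule sum.not_neutral_contains_not_neutral)
  then show ?case using Suc.IH step Suc.prems(1) by blast
qed

end

section \<open>Mixing of the walk along a fixed pairing\<close>

context dense_expander
begin

text \<open>Energy argument: the sum of squared distances from \<open>lo\<close> starts at no more
  than \<open>n * (hi - lo)^2\<close>, and composition with \<open>\<sigma>\<close> preserves it.
  While no step halves the oscillation, \<open>avg_step\<close> removes a fixed amount each time,
  and \<open>K\<close> such losses exceed the initial value. An interval reached before step
  \<open>K\<close> stays valid by \<open>walk_bounds\<close>.\<close>

lemma walk_halves_oscillation:
  fixes m K :: nat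
  assumes m: "real m \<ge> 4 * (1 / \<nu> + 2)" and K: "real K * \<nu>\<^sup>2 > 4 * (real m)\<^sup>2"
    and \<sigma>: "pairing \<sigma>" and g: "\<forall>x\<in>V. lo \<le> g x \<and> g x \<le> hi"
  shows "\<exists>lo' hi'. hi' - lo' \<le> (hi - lo) / 2 \<and> (\<forall>x\<in>V. lo' \<le> (walk \<sigma> ^^ K) g x \<and> (walk \<sigma> ^^ K) g x \<le> hi')"
proof (rule ccontr)
  assume no: "\<not> ?thesis"
  have m0: "real m > 0" using m \<nu>_pos by (smt (verit) divide_pos_pos)
  obtain x0 where "x0 \<in> V" using nonempty by auto
  with g have "lo \<le> hi" by force
  moreover have "lo \<noteq> hi"
  proof
    assume "lo = hi"
    then have "hi - lo \<le> (hi - lo) / 2" by simp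
    then show False using no walk_bounds[OF \<sigma> g, of K] by blast
  qed
  ultimately have lohi: "lo < hi" by simp
  let ?g = "\<lambda>j. (walk \<sigma> ^^ j) g"
  let ?c = "\<nu>\<^sup>2 * ((hi - lo) / m / 2)\<^sup>2 * real n"
  have "(\<Sum>x\<in>V. (?g j x - lo)\<^sup>2) \<le> real n * (hi - lo)\<^sup>2 - real j * ?c" if "j \<le> K" for j
    using that
  proof (induction j)
    case 0
    have "(\<Sum>x\<in>V. (g x - lo)\<^sup>2) \<le> (\<Sum>x\<in>V. (hi - lo)\<^sup>2)"
      using g by (intro sum_mono power_mono) auto
    then show ?case by simp
  next
    case (Suc j)
    let ?f = "\<lambda>z. ?g j (\<sigma> z)"
    have f: "lo \<le> ?f x \<and> ?f x \<le> hi" if "x \<in> V" for x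
      using walk_bounds[OF \<sigma> g, of j] that pairing_in_V[OF \<sigma>] by auto
    have eq: "?g (Suc j) x = avg ?f x" for x by (simp add: walk_def)
    have "\<not> (\<exists>lo' hi'. hi' - lo' \<le> (hi - lo) / 2 \<and> (\<forall>x\<in>V. lo' \<le> avg ?f x \<and> avg ?f x \<le> hi'))"
    proof safe
      fix lo' hi' assume *: "hi' - lo' \<le> (hi - lo) / 2" "\<forall>x\<in>V. lo' \<le> avg ?f x \<and> avg ?f x \<le> hi'"
      have "(walk \<sigma> ^^ (K - Suc j)) (?g (Suc j)) = ?g K"
        using Suc.prems by (simp flip: funpow_add comp_apply[of "walk \<sigma> ^^ _"] del: funpow.simps)
      then have "\<forall>x\<in>V. lo' \<le> ?g K x \<and> ?g K x \<le> hi'"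
        using walk_bounds[OF \<sigma>, of lo' "?g (Suc j)" hi' "K - Suc j"] *(2) eq by simp
      then show False using no *(1) by blast
    qed
    with avg_step[OF m lohi, of ?f] f
    have "(\<Sum>x\<in>V. (avg ?f x - lo)\<^sup>2) \<le> (\<Sum>x\<in>V. (?f x - lo)\<^sup>2) - ?c" by blast
    also have "(\<Sum>x\<in>V. (?f x - lo)\<^sup>2) = (\<Sum>x\<in>V. (?g j x - lo)\<^sup>2)"
      by (rule sum_pairing[OF \<sigma>])
    finally show ?case using Suc unfolding eq by (simp add: algebra_simps)
  qed
  from this[of K] have "0 \<le> real n * (hi - lo)\<^sup>2 - real K * ?c"
    by (meson order_trans order_refl sum_nonneg zero_le_power2)
  also have "\<dots> = real n * (hi - lo)\<^sup>2 * (1 - real K * \<nu>\<^sup>2 / (4 * (real m)\<^sup>2))"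
    by (simp add: power_divide algebra_simps)
  finally have "0 \<le> real n * (hi - lo)\<^sup>2 * (1 - real K * \<nu>\<^sup>2 / (4 * (real m)\<^sup>2))" .
  moreover have "0 < real n * (hi - lo)\<^sup>2" using n_pos lohi by simp
  ultimately have "0 \<le> 1 - real K * \<nu>\<^sup>2 / (4 * (real m)\<^sup>2)"
    by (meson mult_pos_neg not_less)
  then have "real K * \<nu>\<^sup>2 \<le> 4 * (real m)\<^sup>2" using m0 by (simp add: divide_le_eq)
  then show False using K by simp
qed

text \<open>After \<open>j\<close> halvings all values lie in an interval of length
  \<open>(1 / 2) ^ j\<close>, which also contains the mean of \<open>h\<close> since the walk
  preserves sums.\<close>

lemma walk_mixing:
  fixes m K :: nat
  assumes m: "real m \<ge> 4 * (1 / \<nu> + 2)" and K: "real K * \<nu>\<^sup>2 > 4 * (real m)\<^sup>2"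
    and \<sigma>: "pairing \<sigma>" and h: "\<forall>x\<in>V. 0 \<le> h x \<and> h x \<le> 1" and x: "x \<in> V"
  shows "\<bar>(walk \<sigma> ^^ (j * K)) h x - (\<Sum>z\<in>V. h z) / real n\<bar> \<le> (1 / 2) ^ j"
proof -
  have "\<exists>lo hi. hi - lo \<le> (1 / 2) ^ j \<and> (\<forall>x\<in>V. lo \<le> (walk \<sigma> ^^ (j * K)) h x \<and> (walk \<sigma> ^^ (j * K)) h x \<le> hi)"
  proof (induction j)
    case 0
    then show ?case using h by (intro exI[of _ 0] exI[of _ 1]) auto
  next
    case (Suc j)
    then obtain lo hi where 1: "hi - lo \<le> (1 / 2) ^ j"
      "\<forall>x\<in>V. lo \<le> (walk \<sigma> ^^ (j * K)) h x \<and> (walk \<sigma> ^^ (j * K)) h x \<le> hi" by blast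
    obtain lo' hi' where 2: "hi' - lo' \<le> (hi - lo) / 2"
      "\<forall>x\<in>V. lo' \<le> (walk \<sigma> ^^ K) ((walk \<sigma> ^^ (j * K)) h) x \<and> (walk \<sigma> ^^ K) ((walk \<sigma> ^^ (j * K)) h) x \<le> hi'"
      using walk_halves_oscillation[OF m K \<sigma> 1(2)] by blast
    have "hi' - lo' \<le> (1 / 2) ^ Suc j" using 1(1) 2(1) by simp
    then show ?case using 2(2) by (auto simp: funpow_add)
  qed
  then obtain lo hi where 1: "hi - lo \<le> (1 / 2) ^ j"
    "\<forall>x\<in>V. lo \<le> (walk \<sigma> ^^ (j * K)) h x \<and> (walk \<sigma> ^^ (j * K)) h x \<le> hi" by blast
  have "(\<Sum>z\<in>V. h z) = (\<Sum>z\<in>V. (walk \<sigma> ^^ (j * K)) h z)" using sum_walk[OF \<sigma>] by simp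
  moreover have "(\<Sum>z\<in>V. (walk \<sigma> ^^ (j * K)) h z) \<le> (\<Sum>z\<in>V. hi)"
    "(\<Sum>z\<in>V. lo) \<le> (\<Sum>z\<in>V. (walk \<sigma> ^^ (j * K)) h z)"
    using 1(2) by (intro sum_mono; simp)+
  ultimately have "lo \<le> (\<Sum>z\<in>V. h z) / real n" "(\<Sum>z\<in>V. h z) / real n \<le> hi"
    using n_pos by (simp_all add: field_simps)
  moreover have "lo \<le> (walk \<sigma> ^^ (j * K)) h x" "(walk \<sigma> ^^ (j * K)) h x \<le> hi"
    using 1(2) x by auto
  ultimately show ?thesis using 1(1) by linarith
qed

end

section \<open>Near-perfect matchings and stationarity\<close>

context regular_simple_graph
begin

text \<open>The near-perfect matchings missing \<open>v\<close>. The pair of \<open>v\<close> only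
  records the hole, so its two vertices are exempt from adjacency.\<close>

definition states :: "'a \<Rightarrow> ('a \<Rightarrow> 'a) set" where
  "states v = {\<sigma>. pairing \<sigma> \<and> (\<forall>x\<in>V. x \<noteq> v \<longrightarrow> x \<noteq> \<sigma> v \<longrightarrow> \<sigma> x \<in> N x)}"

lemma finite_states [simp]: "finite (states v)"
  by (rule finite_subset[OF _ finite_pairings]) (auto simp: states_def)

lemma state_pairing: "\<sigma> \<in> states v \<Longrightarrow> pairing \<sigma>"
  by (simp add: states_def)

lemma rematch_state:
  assumes "\<sigma> \<in> states v" "v \<in> V" "z \<in> N (\<sigma> v)"
  shows "rematch v \<sigma> z \<in> states v"
proof -
  have p: "pairing \<sigma>" by (rule state_pairing[OF assms(1)])
  have "rematch v \<sigma> z x \<in> N x" if "x \<in> V" "x \<noteq> v" "x \<noteq> \<sigma> z" for x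
    using that assms N_sym unfolding rematch_apply[OF p assms(2,3)] states_def by auto
  then show ?thesis
    using rematch_pairing[OF p assms(2,3)] rematch_hole[OF p assms(2,3)] by (simp add: states_def)
qed

text \<open>Needed to undo a rematching: the new hole is \<open>\<sigma> z\<close>, so the same
  \<open>z\<close> can be chosen again.\<close>

lemma state_rematch_adjacent:
  assumes "\<sigma> \<in> states v" "v \<in> V" "z \<in> N (\<sigma> v)"
  shows "z \<in> N (\<sigma> z)"
proof (cases "z = v")
  case True
  then show ?thesis using assms by simp
next
  case False
  moreover have "z \<noteq> \<sigma> v" using assms(3) by auto
  ultimately have "\<sigma> z \<in> N z" using assms N_in_V by (auto simp: states_def)
  then show ?thesis using N_sym by blast
qed

lemma rematch_rematch:
  assumes "\<sigma> \<in> states v" "v \<in> V" "z \<in> N (\<sigma> v)"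
  shows "rematch v (rematch v \<sigma> z) z = \<sigma>"
proof
  fix x
  have p: "pairing \<sigma>" by (rule state_pairing[OF assms(1)])
  have r: "pairing (rematch v \<sigma> z)" "z \<in> N (rematch v \<sigma> z v)"
    using rematch_pairing[OF p assms(2,3)] state_rematch_adjacent[OF assms] rematch_hole[OF p assms(2,3)]
    by auto
  have z: "z \<in> V" "z \<noteq> \<sigma> v" using N_in_V[OF assms(3)] assms(3) by auto
  show "rematch v (rematch v \<sigma> z) z x = \<sigma> x"
    unfolding rematch_apply[OF r(1) assms(2) r(2)] rematch_apply[OF p assms(2,3)]
    using pairing_neq[OF p assms(2)] pairing_neq[OF p z(1)] z pairing_involution[OF p]
    by auto
qed

text \<open>Rematching with the same \<open>z\<close> twice is the identity, so \<open>move v\<close> preserves the uniform distribution.\<close>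
lemma sum_move:
  assumes v: "v \<in> V"
  shows "(\<Sum>\<sigma>\<in>states v. move v F \<sigma>) = (\<Sum>\<sigma>\<in>states v. F \<sigma>)"
proof -
  have "(\<Sum>\<sigma>\<in>states v. \<Sum>z\<in>N (\<sigma> v). F (rematch v \<sigma> z))
      = (\<Sum>(\<sigma>, z)\<in>(SIGMA \<sigma>:states v. N (\<sigma> v)). F (rematch v \<sigma> z))"
    by (simp add: sum.Sigma)
  also have "\<dots> = (\<Sum>(\<sigma>, z)\<in>(SIGMA \<sigma>:states v. N (\<sigma> v)). F \<sigma>)"
    by (rule sum.reindex_bij_witness[where i = "\<lambda>(\<sigma>, z). (rematch v \<sigma> z, z)" and j = "\<lambda>(\<sigma>, z). (rematch v \<sigma> z, z)"])
      (auto simp: rematch_rematch rematch_state rematch_hole state_pairing state_rematch_adjacent v)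
  also have "\<dots> = (\<Sum>\<sigma>\<in>states v. \<Sum>z\<in>N (\<sigma> v). F \<sigma>)"
    by (rule sum.Sigma[symmetric]) auto
  also have "\<dots> = (\<Sum>\<sigma>\<in>states v. real d * F \<sigma>)"
    using v by (intro sum.cong refl) (simp add: card_N pairing_in_V[OF state_pairing])
  finally show ?thesis
    using d_pos by (simp add: move_def avg_def flip: sum_divide_distrib sum_distrib_left)
qed

lemma sum_move_power:
  assumes "v \<in> V"
  shows "(\<Sum>\<sigma>\<in>states v. (move v ^^ k) F \<sigma>) = (\<Sum>\<sigma>\<in>states v. F \<sigma>)"
  by (induction k) (simp_all add: sum_move[OF assms])

text \<open>Stationarity for the indicator of hole \<open>y\<close>: a move ends there only by
  choosing \<open>z = \<sigma> y\<close>, which has probability \<open>1 / d\<close> if that vertex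
  is adjacent to the present hole and is impossible otherwise.\<close>

lemma count_hole:
  assumes v: "v \<in> V"
  shows "real d * real (card {\<sigma>\<in>states v. \<sigma> v = y}) = (\<Sum>\<sigma>\<in>states v. of_bool (\<sigma> v \<in> N (\<sigma> y)))"
proof -
  let ?F = "\<lambda>\<sigma>. of_bool (\<sigma> v = y) :: real"
  have "real (card {\<sigma>\<in>states v. \<sigma> v = y}) = (\<Sum>\<sigma>\<in>states v. ?F \<sigma>)"
    by (simp add: Int_def)
  also have "\<dots> = (\<Sum>\<sigma>\<in>states v. move v ?F \<sigma>)" by (rule sum_move[OF v, symmetric])
  also have "\<dots> = (\<Sum>\<sigma>\<in>states v. of_bool (\<sigma> v \<in> N (\<sigma> y)) / real d)"
  proof (intro sum.cong refl)
    fix \<sigma> assume s: "\<sigma> \<in> states v"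
    have p: "pairing \<sigma>" by (rule state_pairing[OF s])
    have "(\<Sum>z\<in>N (\<sigma> v). ?F (rematch v \<sigma> z)) = (\<Sum>z\<in>N (\<sigma> v). if z = \<sigma> y then 1 else 0)"
      by (intro sum.cong refl) (simp add: rematch_hole[OF p v] pairing_eq_iff[OF p])
    also have "\<dots> = of_bool (\<sigma> v \<in> N (\<sigma> y))" using N_sym[of "\<sigma> y" "\<sigma> v"] by simp
    finally show "move v ?F \<sigma> = of_bool (\<sigma> v \<in> N (\<sigma> y)) / real d"
      by (simp add: move_def avg_def)
  qed
  finally show ?thesis using d_pos by (simp flip: sum_divide_distrib)
qed

section \<open>Perfect matchings as pairings along edges\<close>

definition good_pairings :: "('a \<Rightarrow> 'a) set" where
  "good_pairings = {\<sigma>. pairing \<sigma> \<and> (\<forall>x\<in>V. \<sigma> x \<in> N x)}"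

definition pairs :: "('a \<Rightarrow> 'a) \<Rightarrow> 'a set set" where
  "pairs \<sigma> = (\<lambda>x. {x, \<sigma> x}) ` V"

lemma mem_pairs_iff:
  assumes "pairing \<sigma>" "x \<in> V"
  shows "{x, y} \<in> pairs \<sigma> \<longleftrightarrow> \<sigma> x = y"
  using assms pairing_involution[OF assms(1)] by (auto simp: pairs_def doubleton_eq_iff)

lemma pairs_perfect_matching:
  assumes "\<sigma> \<in> good_pairings"
  shows "perfect_matching V E (pairs \<sigma>)"
  unfolding perfect_matching_def
proof safe
  fix e assume "e \<in> pairs \<sigma>"
  then show "e \<in> E" using assms by (auto simp: pairs_def good_pairings_def neighbours_def)
next
  fix v assume v: "v \<in> V"
  show "\<exists>e. e \<in> pairs \<sigma> \<and> v \<in> e" using v by (auto simp: pairs_def)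
next
  fix v e f x assume "e \<in> pairs \<sigma>" "v \<in> e" "f \<in> pairs \<sigma>" "v \<in> f"
  moreover have p: "pairing \<sigma>" using assms by (simp add: good_pairings_def)
  moreover have "e' = {v, \<sigma> v}" if "e' \<in> pairs \<sigma>" "v \<in> e'" for e'
    using that pairing_involution[OF p] by (auto simp: pairs_def)
  ultimately have "e = {v, \<sigma> v}" "f = {v, \<sigma> v}" by blast+
  then show "x \<in> e \<Longrightarrow> x \<in> f" and "x \<in> f \<Longrightarrow> x \<in> e" by auto
qed

lemma bij_betw_pairs: "bij_betw pairs good_pairings {M. perfect_matching V E M}"
proof (rule bij_betw_imageI)
  show "inj_on pairs good_pairings"
  proof (rule inj_onI, rule ext)
    fix \<sigma> \<tau> x assume "\<sigma> \<in> good_pairings" "\<tau> \<in> good_pairings" and eq: "pairs \<sigma> = pairs \<tau>"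
    then have p: "pairing \<sigma>" "pairing \<tau>" by (auto simp: good_pairings_def)
    show "\<sigma> x = \<tau> x"
    proof (cases "x \<in> V")
      case True
      then show ?thesis using mem_pairs_iff[OF p(1) True] mem_pairs_iff[OF p(2) True] eq by metis
    next
      case False
      then show ?thesis using p by (simp add: permutes_not_in[OF pairing_permutes])
    qed
  qed
  show "pairs ` good_pairings = {M. perfect_matching V E M}"
  proof (intro equalityI subsetI)
    fix M assume "M \<in> {M. perfect_matching V E M}"
    then have M: "M \<subseteq> E" "\<And>x. x \<in> V \<Longrightarrow> \<exists>!e. e \<in> M \<and> x \<in> e"
      by (auto simp: perfect_matching_def)
    have edge: "e \<subseteq> V" "card e = 2" if "e \<in> M" for e
      using that M(1) graph by (auto simp: finite_simple_graph_def)
    \<comment> \<open>An edge of \<open>M\<close> at \<open>x\<close> has the form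
      \<open>{x, y}\<close>, so a choice exists; uniqueness of that edge makes the map an
      involution.\<close>
    define \<sigma> where "\<sigma> x = (if x \<in> V then SOME y. {x, y} \<in> M else x)" for x
    have \<sigma>M: "{x, \<sigma> x} \<in> M" if x: "x \<in> V" for x
    proof -
      obtain e where e: "e \<in> M" "x \<in> e" using M(2)[OF x] by auto
      obtain a b where "e = {a, b}" using edge(2)[OF e(1)] unfolding card_2_iff by blast
      then have "e = {x, a} \<or> e = {x, b}" using e(2) by blast
      then have "\<exists>y. {x, y} \<in> M" using e(1) by blast
      then have "{x, SOME y. {x, y} \<in> M} \<in> M" by (rule someI_ex)
      then show ?thesis using x by (simp add: \<sigma>_def)
    qed
    have \<sigma>V: "\<sigma> x \<in> V" "\<sigma> x \<noteq> x" if x: "x \<in> V" for x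
      using edge[OF \<sigma>M[OF x]] by (auto simp: card_2_iff)
    have inv: "\<sigma> (\<sigma> x) = x" if x: "x \<in> V" for x
    proof -
      have "{\<sigma> x, \<sigma> (\<sigma> x)} = {x, \<sigma> x}"
        using M(2)[OF \<sigma>V(1)[OF x]] \<sigma>M[OF x] \<sigma>M[OF \<sigma>V(1)[OF x]] by blast
      then show ?thesis by (auto simp: doubleton_eq_iff)
    qed
    have "pairing \<sigma>" by (rule pairingI) (use \<sigma>V inv in \<open>auto simp: \<sigma>_def\<close>)
    moreover have "\<sigma> x \<in> N x" if "x \<in> V" for x
      using \<sigma>M[OF that] M(1) by (auto simp: neighbours_def)
    moreover have "pairs \<sigma> = M"
    proof (intro equalityI subsetI)
      fix e assume "e \<in> pairs \<sigma>"
      then show "e \<in> M" using \<sigma>M by (auto simp: pairs_def)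
    next
      fix e assume e: "e \<in> M"
      then have "e \<noteq> {}" using edge(2) by force
      then obtain x where x: "x \<in> V" "x \<in> e" using edge(1)[OF e] by blast
      then have "e = {x, \<sigma> x}" using M(2)[OF x(1)] \<sigma>M[OF x(1)] e by blast
      then show "e \<in> pairs \<sigma>" using x by (auto simp: pairs_def)
    qed
    ultimately show "M \<in> pairs ` good_pairings" by (auto simp: good_pairings_def)
  qed (use pairs_perfect_matching in auto)
qed

lemma finite_good_pairings [simp]: "finite good_pairings"
  by (rule finite_subset[OF _ finite_pairings]) (auto simp: good_pairings_def)

text \<open>A hole adjacent to \<open>v\<close> makes the pair of \<open>v\<close> an edge too,
  which completes the near-perfect matching.\<close>

lemma good_pairings_hole:
  assumes "v \<in> V" "w \<in> N v"
  shows "{\<sigma>\<in>good_pairings. \<sigma> v = w} = {\<sigma>\<in>states v. \<sigma> v = w}"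
proof -
  have "\<sigma> x \<in> N x" if "\<sigma> \<in> states v" "\<sigma> v = w" "x \<in> V" for \<sigma> x
  proof -
    have "\<sigma> w = v" using that pairing_involution[OF state_pairing] by metis
    then show ?thesis using that assms N_sym[of v w] by (cases "x = v \<or> x = w") (auto simp: states_def)
  qed
  then show ?thesis by (auto simp: good_pairings_def states_def)
qed

text \<open>Perfect matchings are classified by the partner of \<open>v\<close>, which ranges over
  \<open>N v\<close>; each class is counted by the states with that hole.\<close>

lemma prob_edge:
  assumes v: "v \<in> V" and u: "u \<in> N v"
  shows "\<P>(M in random_perfect_matching V E. {v, u} \<in> M)
    = real (card {\<sigma>\<in>states v. \<sigma> v = u}) / (\<Sum>w\<in>N v. real (card {\<sigma>\<in>states v. \<sigma> v = w}))"
proof -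
  let ?PM = "{M. perfect_matching V E M}"
  have fin: "finite ?PM" using bij_betw_finite[OF bij_betw_pairs] by simp
  have 1: "card ?PM = card good_pairings" using bij_betw_same_card[OF bij_betw_pairs] by simp
  have "good_pairings = (\<Union>w\<in>N v. {\<sigma>\<in>good_pairings. \<sigma> v = w})"
    using v by (auto simp: good_pairings_def)
  then have "card good_pairings = card (\<Union>w\<in>N v. {\<sigma>\<in>good_pairings. \<sigma> v = w})" by simp
  also have "\<dots> = (\<Sum>w\<in>N v. card {\<sigma>\<in>good_pairings. \<sigma> v = w})"
    by (rule card_UN_disjoint) auto
  finally have 2: "card good_pairings = (\<Sum>w\<in>N v. card {\<sigma>\<in>states v. \<sigma> v = w})"
    using v by (simp add: good_pairings_hole)
  have "bij_betw pairs {\<sigma>\<in>good_pairings. \<sigma> v = u} {M\<in>?PM. {v, u} \<in> M}"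
  proof (rule bij_betw_subset[OF bij_betw_pairs])
    have "{v, u} \<in> pairs \<sigma> \<longleftrightarrow> \<sigma> v = u" if "\<sigma> \<in> good_pairings" for \<sigma>
      using that by (intro mem_pairs_iff v) (simp add: good_pairings_def)
    then show "pairs ` {\<sigma>\<in>good_pairings. \<sigma> v = u} = {M\<in>?PM. {v, u} \<in> M}"
      unfolding bij_betw_imp_surj_on[OF bij_betw_pairs, symmetric] by auto
  qed auto
  from bij_betw_same_card[OF this]
  have 3: "card {M\<in>?PM. {v, u} \<in> M} = card {\<sigma>\<in>states v. \<sigma> v = u}"
    using good_pairings_hole[OF v u] by simp
  have "\<P>(M in random_perfect_matching V E. {v, u} \<in> M) = measure (uniform_count_measure ?PM) {M\<in>?PM. {v, u} \<in> M}"
    by (simp add: random_perfect_matching_def space_uniform_count_measure)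
  also have "\<dots> = real (card {M\<in>?PM. {v, u} \<in> M}) / real (card ?PM)"
    by (rule measure_uniform_count_measure[OF fin]) auto
  finally show ?thesis unfolding 1 2 3 by simp
qed

text \<open>Number the vertices from 0 and pair each even number with its successor. This provides
  the starting point for \<open>states_nonempty\<close>.\<close>

lemma pairing_exists:
  assumes "even n"
  shows "\<exists>\<sigma>. pairing \<sigma>"
proof -
  obtain h where h: "bij_betw h {0..<n} V" using ex_bij_betw_nat_finite[OF finite_V] by auto
  define g where "g = inv_into {0..<n} h"
  define flip where "flip i = (if even i then Suc i else i - 1)" for i :: nat
  define \<sigma> where "\<sigma> x = (if x \<in> V then h (flip (g x)) else x)" for x
  have flip: "flip i < n" "flip i \<noteq> i" "flip (flip i) = i" if "i < n" for i
    using that assms by (auto simp: flip_def elim!: oddE evenE)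
  have hg: "h (g x) = x" "g x < n" if "x \<in> V" for x
    using that h bij_betw_inv_into_right[OF h that] bij_betwE[OF bij_betw_inv_into[OF h]]
    by (auto simp: g_def)
  have gh: "g (h i) = i" "h i \<in> V" if "i < n" for i
    using that bij_betw_inv_into_left[OF h, of i] bij_betwE[OF h] by (auto simp: g_def)
  have "pairing \<sigma>"
  proof (rule pairingI)
    fix x assume x: "x \<in> V"
    note i = hg(2)[OF x]
    have "g (h (flip (g x))) \<noteq> g x" using flip[OF i] gh(1) by simp
    then have "h (flip (g x)) \<noteq> x" by auto
    then show "\<sigma> x \<in> V \<and> \<sigma> x \<noteq> x \<and> \<sigma> (\<sigma> x) = x"
      using x flip[OF i] gh hg(1)[OF x] by (simp add: \<sigma>_def)
  qed (simp add: \<sigma>_def)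
  then show ?thesis by blast
qed

end

section \<open>Almost uniform holes and edge probabilities\<close>

context dense_expander
begin

text \<open>\<open>move_walk\<close> passes to the walk along the initial \<open>\<sigma>\<close>,
  and \<open>walk_mixing\<close> replaces that by the mean of the indicator of \<open>N w\<close>,
  which is \<open>d / n\<close> by regularity.\<close>

lemma move_adjacent_prob:
  fixes m K :: nat
  assumes m: "real m \<ge> 4 * (1 / \<nu> + 2)" and K: "real K * \<nu>\<^sup>2 > 4 * (real m)\<^sup>2"
    and k: "k = j * K"
    and \<sigma>: "pairing \<sigma>" and v: "v \<in> V" and w: "w \<in> V"
  shows "\<bar>(move v ^^ k) (\<lambda>\<tau>. of_bool (\<tau> v \<in> N w)) \<sigma> - real d / real n\<bar>
    \<le> 4 * (real k)\<^sup>2 / real d + (1 / 2) ^ j"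
proof -
  let ?h = "\<lambda>x. of_bool (x \<in> N w) :: real"
  have h: "\<forall>x\<in>V. 0 \<le> ?h x \<and> ?h x \<le> 1" by simp
  have "(\<Sum>x\<in>V. ?h x) = real (card (V \<inter> N w))" by (simp add: Int_def)
  also have "V \<inter> N w = N w" using N_sub by auto
  finally have "(\<Sum>x\<in>V. ?h x) = real d" using card_N[OF w] by simp
  moreover have "\<sigma> v \<in> V" using v pairing_in_V[OF \<sigma>] by simp
  ultimately show ?thesis
    using move_walk[OF v h \<sigma>, of k] walk_mixing[OF m K \<sigma> h, of "\<sigma> v" j] k by fastforce
qed

text \<open>
  Moving the hole creates no new non-edge pair apart from that of \<open>v\<close>, and some sequence of moves
  brings the hole next to \<open>v\<close>. Hence a pairing with the fewest non-edges has none.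
\<close>
lemma states_nonempty:
  fixes m K :: nat
  assumes m: "real m \<ge> 4 * (1 / \<nu> + 2)" and K: "real K * \<nu>\<^sup>2 > 4 * (real m)\<^sup>2"
    and k: "k = j * K" and small: "4 * (real k)\<^sup>2 / real d + (1 / 2) ^ j < \<delta>"
    and "even n"
  shows "states v \<noteq> {}"
proof -
  define bad where "bad \<sigma> = {x\<in>V. \<sigma> x \<notin> N x}" for \<sigma>
  obtain \<sigma> where \<sigma>: "pairing \<sigma>" and min: "\<And>\<tau>. pairing \<tau> \<Longrightarrow> card (bad \<sigma>) \<le> card (bad \<tau>)"
    using ex_has_least_nat[of pairing _ "\<lambda>\<sigma>. card (bad \<sigma>)"] pairing_exists[OF \<open>even n\<close>] by blast
  have "bad \<sigma> = {}"
  proof (rule ccontr)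
    assume "bad \<sigma> \<noteq> {}"
    then obtain y where y: "y \<in> V" "\<sigma> y \<notin> N y" by (auto simp: bad_def)
    \<comment> \<open>Here \<open>y\<close> plays the role of \<open>v\<close>. Outside the current
      pair of \<open>y\<close>, only vertices bad from the start may be bad.\<close>
    define I where "I \<tau> \<longleftrightarrow> pairing \<tau> \<and> bad \<tau> - {y, \<tau> y} \<subseteq> bad \<sigma> - {y}" for \<tau>
    have I: "I (rematch y \<tau> z)" if \<tau>: "I \<tau>" and z: "z \<in> N (\<tau> y)" for \<tau> z
    proof -
      have p: "pairing \<tau>" using \<tau> by (simp add: I_def)
      have "bad (rematch y \<tau> z) - {y, \<tau> z} \<subseteq> bad \<tau> - {y, \<tau> y}"
        using z N_sym[of z "\<tau> y"] by (auto simp: bad_def rematch_apply[OF p y(1) z] split: if_splits)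
      then show ?thesis
        using \<tau> rematch_hole[OF p y(1) z] rematch_pairing[OF p y(1) z] by (auto simp: I_def)
    qed
    have "\<delta> \<le> real d / real n" using dense n_pos by (simp add: le_divide_eq)
    then have "(move y ^^ k) (\<lambda>\<tau>. of_bool (\<tau> y \<in> N y)) \<sigma> \<noteq> 0"
      using move_adjacent_prob[OF m K k \<sigma> y(1) y(1)] small by linarith
    moreover have "I \<sigma>" using \<sigma> by (auto simp: I_def)
    ultimately obtain \<tau> where \<tau>: "I \<tau>" "\<tau> y \<in> N y"
      using move_positive_reachable[where I = I and v = y, OF y(1) I, of \<sigma> k "\<lambda>\<tau>. of_bool (\<tau> y \<in> N y)"]
      by auto
    have p: "pairing \<tau>" using \<tau> by (simp add: I_def)
    \<comment> \<open>The pair of \<open>y\<close> is now an edge, so \<open>y\<close> has left the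
      bad set, against minimality.\<close>
    have "bad \<tau> \<subseteq> bad \<tau> - {y, \<tau> y}"
      using \<tau>(2) N_sym[of "\<tau> y" y] pairing_involution[OF p] by (auto simp: bad_def)
    then have "bad \<tau> \<subseteq> bad \<sigma> - {y}" using \<tau>(1) by (auto simp: I_def)
    moreover have "y \<in> bad \<sigma>" "finite (bad \<sigma>)" using y by (auto simp: bad_def)
    ultimately have "card (bad \<tau>) < card (bad \<sigma>)" by (intro psubset_card_mono) auto
    then show False using min[OF p] by simp
  qed
  then have "\<sigma> \<in> states v" using \<sigma> by (auto simp: states_def bad_def)
  then show ?thesis by auto
qed

text \<open>By \<open>count_hole\<close> and stationarity, \<open>d\<close> times the count is the
  sum over all states of the probability that after \<open>k\<close> moves the hole is adjacent to
  the partner of \<open>y\<close>. Freezing that partner by \<open>move_adjacent\<close> gives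
  \<open>d / n\<close> up to \<open>\<epsilon>\<close>. This needs a state whose hole is not
  \<open>y\<close>; the others are charged 1 each, whence the last term.\<close>

lemma hole_almost_uniform:
  fixes m K :: nat
  assumes m: "real m \<ge> 4 * (1 / \<nu> + 2)" and K: "real K * \<nu>\<^sup>2 > 4 * (real m)\<^sup>2"
    and k: "k = j * K" and v: "v \<in> V" and y: "y \<in> V" "y \<noteq> v"
    and \<epsilon>: "\<epsilon> = (4 * (real k)\<^sup>2 + 2 * real k) / real d + (1 / 2) ^ j"
  shows "\<bar>real d * real (card {\<sigma>\<in>states v. \<sigma> v = y}) - real (card (states v)) * (real d / real n)\<bar>
    \<le> \<epsilon> * real (card (states v)) + real (card {\<sigma>\<in>states v. \<sigma> v = y})"
proof -
  let ?F = "\<lambda>\<sigma>. of_bool (\<sigma> v \<in> N (\<sigma> y)) :: real"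
  have e0: "\<epsilon> \<ge> 0" unfolding \<epsilon> by simp
  have dn: "d \<le> n" using card_N[OF v] N_sub[of v] by (metis card_mono finite_V)
  have *: "\<bar>(move v ^^ k) ?F \<sigma> - real d / real n\<bar> \<le> \<epsilon> + of_bool (\<sigma> v = y)" if s: "\<sigma> \<in> states v" for \<sigma>
  proof (cases "\<sigma> v = y")
    case True
    have "0 \<le> (move v ^^ k) ?F \<sigma> \<and> (move v ^^ k) ?F \<sigma> \<le> 1"
      by (rule move_bounds[OF v _ state_pairing[OF s]]) simp
    moreover have "0 \<le> real d / real n" "real d / real n \<le> 1"
      using dn n_pos by (simp_all add: divide_le_eq)
    ultimately have "\<bar>(move v ^^ k) ?F \<sigma> - real d / real n\<bar> \<le> 1" by linarith
    then show ?thesis using True e0 by simp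
  next
    case False
    note p = state_pairing[OF s]
    have "\<sigma> y \<in> V" using y pairing_in_V[OF p] by simp
    from move_adjacent_prob[OF m K k p v this] move_adjacent[OF v y(2) p False[symmetric], of k]
    have "\<bar>(move v ^^ k) ?F \<sigma> - real d / real n\<bar> \<le> 4 * (real k)\<^sup>2 / real d + (1 / 2) ^ j + 2 * real k / real d"
      by linarith
    then show ?thesis using False by (simp add: \<epsilon> add_divide_distrib)
  qed
  have "real d * real (card {\<sigma>\<in>states v. \<sigma> v = y}) - real (card (states v)) * (real d / real n)
      = (\<Sum>\<sigma>\<in>states v. (move v ^^ k) ?F \<sigma> - real d / real n)"
    unfolding count_hole[OF v] sum_move_power[OF v, of k ?F, symmetric] by (simp add: sum_subtractf)
  also have "\<bar>\<dots>\<bar> \<le> (\<Sum>\<sigma>\<in>states v. \<bar>(move v ^^ k) ?F \<sigma> - real d / real n\<bar>)" by (rule sum_abs)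
  also have "\<dots> \<le> (\<Sum>\<sigma>\<in>states v. \<epsilon> + of_bool (\<sigma> v = y))" by (intro sum_mono *)
  also have "\<dots> = \<epsilon> * real (card (states v)) + real (card {\<sigma>\<in>states v. \<sigma> v = y})"
    by (simp add: sum.distrib Int_def)
  finally show ?thesis .
qed

text \<open>The hole counts at all neighbours of \<open>v\<close> are close to the same
  \<open>c\<close>, so each is close to a \<open>1 / d\<close> share of their sum.\<close>

lemma edge_prob:
  fixes m K :: nat
  assumes m: "real m \<ge> 4 * (1 / \<nu> + 2)" and K: "real K * \<nu>\<^sup>2 > 4 * (real m)\<^sup>2"
    and k: "k = j * K" and "even n" and e: "e \<in> E"
    and \<beta>: "((4 * (real k)\<^sup>2 + 2 * real k) / real d + (1 / 2) ^ j) / \<delta> + 3 / real d \<le> \<beta>" "\<beta> \<le> 1 / 2"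
  shows "\<bar>real d * \<P>(M in random_perfect_matching V E. e \<in> M) - 1\<bar> \<le> 4 * \<beta>"
proof -
  define \<epsilon> where "\<epsilon> = (4 * (real k)\<^sup>2 + 2 * real k) / real d + (1 / 2) ^ j"
  have e0: "\<epsilon> > 0" unfolding \<epsilon>_def by (intro add_nonneg_pos) auto
  have e1: "\<epsilon> / \<delta> + 3 / real d \<le> \<beta>" using \<beta> by (simp add: \<epsilon>_def)
  have d3: "3 / real d > 0" "1 / real d > 0" "3 / real d = 3 * (1 / real d)" using d_pos by auto
  have e\<delta>: "\<epsilon> / \<delta> > 0" using e0 \<delta>_pos by simp
  obtain v u where vu: "e = {v, u}" "v \<in> V" "u \<in> N v"
  proof -
    obtain v u where "e = {v, u}" using e graph by (auto simp: finite_simple_graph_def card_2_iff)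
    moreover have "v \<in> V" using e graph calculation by (auto simp: finite_simple_graph_def)
    ultimately show ?thesis using that e by (auto simp: neighbours_def)
  qed
  note v = vu(2)
  have "\<epsilon> < \<delta>" using e1 \<beta>(2) d3 \<delta>_pos
    by (smt (verit) divide_less_eq_1_pos divide_less_eq_1)
  moreover have "4 * (real k)\<^sup>2 / real d \<le> (4 * (real k)\<^sup>2 + 2 * real k) / real d"
    by (intro divide_right_mono) auto
  ultimately have "4 * (real k)\<^sup>2 / real d + (1 / 2) ^ j < \<delta>" unfolding \<epsilon>_def by linarith
  then have "states v \<noteq> {}" using states_nonempty[OF m K k _ \<open>even n\<close>] by blast
  then have T0: "card (states v) > 0" by (simp add: card_gt_0_iff)
  define Z where "Z w = real (card {\<sigma>\<in>states v. \<sigma> v = w})" for w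
  define c where "c = real (card (states v)) / real n"
  have c: "c > 0" using T0 n_pos by (simp add: c_def)
  have Tc: "real (card (states v)) = real n * c" using nonempty unfolding c_def by simp
  have Z: "\<bar>Z w - c\<bar> \<le> \<beta> * c" if w: "w \<in> N v" for w
  proof -
    have "w \<noteq> v" using w by auto
    from hole_almost_uniform[OF m K k v N_in_V[OF w] this \<epsilon>_def, folded Z_def]
    have "\<bar>real d * Z w - real d * c\<bar> \<le> \<epsilon> * real n * c + Z w"
      unfolding c_def[symmetric] Tc using nonempty by (simp add: mult_ac)
    also have "\<bar>real d * Z w - real d * c\<bar> = real d * \<bar>Z w - c\<bar>"
      by (simp add: abs_mult flip: right_diff_distrib)
    also have "\<epsilon> * real n * c \<le> \<epsilon> * (real d / \<delta>) * c"
      using dense \<delta>_pos e0 c by (intro mult_right_mono mult_left_mono) (auto simp: le_divide_eq mult.commute)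
    finally have "real d * \<bar>Z w - c\<bar> \<le> real d * (\<epsilon> / \<delta> * c + 1 / real d * Z w)"
      using d_pos by (simp add: algebra_simps)
    then have 1: "\<bar>Z w - c\<bar> \<le> \<epsilon> / \<delta> * c + 1 / real d * Z w" using d_pos by simp
    \<comment> \<open>The error still contains \<open>Z w\<close>. The crude bound
      \<open>Z w \<le> 3 * c\<close> is derived first and fed back, which is the source of
      \<open>3 / d\<close> in the hypothesis on \<open>\<beta>\<close>.\<close>
    have "\<epsilon> / \<delta> * c \<le> 1 / 2 * c" using e1 \<beta>(2) d3 c by (intro mult_right_mono) linarith+
    moreover have "1 / real d \<le> 1 / 2" using e1 \<beta>(2) d3 e\<delta> by linarith
    then have "1 / real d * Z w \<le> 1 / 2 * Z w" by (rule mult_right_mono) (simp add: Z_def)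
    ultimately have "Z w \<le> 3 * c" using 1 by linarith
    then have "1 / real d * Z w \<le> 1 / real d * (3 * c)" using d3(2) by (intro mult_left_mono) auto
    then have "\<bar>Z w - c\<bar> \<le> (\<epsilon> / \<delta> + 3 / real d) * c" using 1 by (simp add: algebra_simps)
    also have "\<dots> \<le> \<beta> * c" using e1 c by (intro mult_right_mono) auto
    finally show ?thesis .
  qed
  define S where "S = (\<Sum>w\<in>N v. Z w)"
  have "\<bar>S - real d * c\<bar> = \<bar>\<Sum>w\<in>N v. Z w - c\<bar>"
    using card_N[OF v] by (simp add: S_def sum_subtractf)
  also have "\<dots> \<le> (\<Sum>w\<in>N v. \<beta> * c)" by (intro order.trans[OF sum_abs] sum_mono Z)
  also have "\<dots> = real d * (\<beta> * c)" using card_N[OF v] by simp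
  finally have S: "\<bar>S - real d * c\<bar> \<le> \<beta> * (real d * c)" by (simp add: mult_ac)
  have "\<bar>real d * Z u - real d * c\<bar> = real d * \<bar>Z u - c\<bar>"
    by (simp add: abs_mult flip: right_diff_distrib)
  also have "\<dots> \<le> real d * (\<beta> * c)" by (intro mult_left_mono Z vu) auto
  finally have Zu: "\<bar>real d * Z u - real d * c\<bar> \<le> \<beta> * (real d * c)" by (simp add: mult_ac)
  have dc: "real d * c > 0" using d_pos c by simp
  then have "\<beta> * (real d * c) \<le> 1 / 2 * (real d * c)" using \<beta>(2) by (intro mult_right_mono) auto
  then have S2: "real d * c \<le> 2 * S" using S by linarith
  have b0: "\<beta> \<ge> 0" using e1 d3 e\<delta> by linarith
  \<comment> \<open>Both \<open>S\<close> and \<open>d * Z u\<close> lie within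
    \<open>\<beta> * d * c\<close> of \<open>d * c\<close>; as \<open>d * c \<le> 2 * S\<close>, the
    relative error is at most \<open>4 * \<beta>\<close>.\<close>
  have "\<bar>real d * Z u - S\<bar> \<le> 2 * \<beta> * (real d * c)" using S Zu by linarith
  also have "\<dots> \<le> 2 * \<beta> * (2 * S)" using S2 b0 by (intro mult_left_mono) auto
  finally have "\<bar>real d * Z u - S\<bar> \<le> 4 * \<beta> * S" by simp
  moreover have "S > 0" using S2 dc by linarith
  moreover have "real d * (Z u / S) - 1 = (real d * Z u - S) / S"
    using \<open>S > 0\<close> by (simp add: diff_divide_distrib)
  ultimately have "\<bar>real d * (Z u / S) - 1\<bar> \<le> 4 * \<beta>" by (simp add: divide_le_eq)
  then show ?thesis unfolding vu(1) prob_edge[OF v vu(3)] S_def Z_def .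
qed

end

section \<open>Choice of constants and a uniform rate\<close>

lemma eventually_edge_prob:
  fixes \<delta> \<nu> \<epsilon> :: real
  assumes "\<delta> > 0" "\<nu> > 0" "\<epsilon> > 0"
  shows "\<exists>n0::nat. \<forall>d (V::'a set) E e. card V \<ge> n0 \<and> even (card V) \<and> real d \<ge> \<delta> * real (card V) \<and>
      finite_simple_graph V E \<and> regular_graph d V E \<and> robust_expander \<nu> (\<delta> / 8) V E \<and> e \<in> E \<longrightarrow>
      \<bar>real d * \<P>(M in random_perfect_matching V E. e \<in> M) - 1\<bar> \<le> \<epsilon>"
proof -
  define \<beta> where "\<beta> = min (1 / 2) (\<epsilon> / 4)"
  have \<beta>: "\<beta> > 0" "\<beta> \<le> 1 / 2" "4 * \<beta> \<le> \<epsilon>" using assms by (auto simp: \<beta>_def)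
  \<comment> \<open>Each of \<open>m\<close>, \<open>K\<close>, \<open>j\<close>, \<open>k\<close>,
    \<open>n0\<close> is chosen from \<open>\<delta>\<close>, \<open>\<nu>\<close>,
    \<open>\<epsilon>\<close> and the earlier ones only, hence uniformly over all graphs.\<close>
  obtain m :: nat where m: "real m \<ge> 4 * (1 / \<nu> + 2)" using real_arch_simple by blast
  obtain K :: nat where "4 * (real m)\<^sup>2 / \<nu>\<^sup>2 < real K" using reals_Archimedean2 by blast
  then have K: "real K * \<nu>\<^sup>2 > 4 * (real m)\<^sup>2" using assms by (simp add: divide_less_eq)
  obtain j where j: "(1 / 2) ^ j < \<delta> * \<beta> / 2"
    using real_arch_pow_inv[of "\<delta> * \<beta> / 2" "1 / 2"] assms \<beta> by auto
  define k where "k = j * K"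
  \<comment> \<open>\<open>x\<close> collects the error terms of order \<open>1 / d\<close>; these
    and the mixing error each receive half of \<open>\<beta>\<close>.\<close>
  define x where "x = (4 * (real k)\<^sup>2 + 2 * real k) / \<delta> + 3"
  have x: "x > 0" using assms by (simp add: x_def add_nonneg_pos)
  obtain n0 :: nat where n0: "2 * x / (\<beta> * \<delta>) \<le> real n0" using real_arch_simple by blast
  show ?thesis
  proof (intro exI[of _ "Suc n0"] allI impI, elim conjE)
    fix d and V :: "'a set" and E e
    assume A: "card V \<ge> Suc n0" "even (card V)" "real d \<ge> \<delta> * real (card V)"
      "finite_simple_graph V E" "regular_graph d V E" "robust_expander \<nu> (\<delta> / 8) V E" "e \<in> E"
    have V: "V \<noteq> {}" using A(1) by auto
    have "\<delta> * real (card V) > 0" using A(1) assms by simp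
    then have "d > 0" using A(3) by (cases d) auto
    then interpret dense_expander V E d \<nu> \<delta>
      using A assms V by unfold_locales auto
    have "2 * x / (\<beta> * \<delta>) \<le> real (card V)" using n0 A(1) by linarith
    then have "2 * x / \<beta> \<le> \<delta> * real (card V)" using assms \<beta> by (simp add: field_simps)
    then have "2 * x / \<beta> \<le> real d" using A(3) by linarith
    then have xd: "x / real d \<le> \<beta> / 2" using \<beta> \<open>d > 0\<close> by (simp add: field_simps)
    have "(1 / 2) ^ j / \<delta> \<le> \<beta> / 2" using j assms by (simp add: field_simps)
    moreover have "((4 * (real k)\<^sup>2 + 2 * real k) / real d + (1 / 2) ^ j) / \<delta> + 3 / real d = x / real d + (1 / 2) ^ j / \<delta>"
      by (simp add: x_def add_divide_distrib mult.commute)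
    ultimately have "((4 * (real k)\<^sup>2 + 2 * real k) / real d + (1 / 2) ^ j) / \<delta> + 3 / real d \<le> \<beta>"
      using xd by linarith
    from edge_prob[OF m K k_def A(2,7) this \<beta>(2)] \<beta>(3)
    show "\<bar>real d * \<P>(M in random_perfect_matching V E. e \<in> M) - 1\<bar> \<le> \<epsilon>" by linarith
  qed
qed

text \<open>The rate is the supremum of the errors over all instances of size \<open>n\<close>:
  finite from the threshold for error 1 onwards, and forced to 0 by later thresholds.\<close>

lemma uniform_rate:
  fixes f :: "nat \<Rightarrow> 'b \<Rightarrow> real"
  assumes "\<And>\<epsilon>. \<epsilon> > 0 \<Longrightarrow> \<exists>n0. \<forall>n\<ge>n0. \<forall>x. Q n x \<longrightarrow> f n x \<le> \<epsilon>"
  shows "\<exists>(n0::nat) \<eta>. (\<forall>n. \<eta> n \<ge> 0) \<and> \<eta> \<longlonglongrightarrow> 0 \<and> (\<forall>n\<ge>n0. \<forall>x. Q n x \<longrightarrow> f n x \<le> \<eta> n)"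
proof -
  obtain n0 where n0: "\<And>n x. n \<ge> n0 \<Longrightarrow> Q n x \<Longrightarrow> f n x \<le> 1" using assms[of 1] by auto
  \<comment> \<open>Inserting 0 keeps the set nonempty even if there is no instance, and its
    supremum nonnegative.\<close>
  define A where "A n = insert 0 (f n ` {x. Q n x})" for n
  define \<eta> where "\<eta> n = (if n \<ge> n0 then Sup (A n) else 0)" for n
  have bdd: "bdd_above (A n)" if "n \<ge> n0" for n
    using n0[OF that] by (intro bdd_aboveI[of _ 1]) (auto simp: A_def)
  have up: "a \<le> \<eta> n" if "n \<ge> n0" "a \<in> A n" for n a
    using cSup_upper[OF that(2) bdd[OF that(1)]] that(1) by (simp add: \<eta>_def)
  have nonneg: "\<eta> n \<ge> 0" for n
    using up[of n 0] by (cases "n \<ge> n0") (auto simp: A_def \<eta>_def)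
  have "\<eta> \<longlonglongrightarrow> 0"
  proof (rule LIMSEQ_I)
    fix r :: real assume "r > 0"
    then obtain n1 where n1: "\<And>n x. n \<ge> n1 \<Longrightarrow> Q n x \<Longrightarrow> f n x \<le> r / 2" using assms[of "r / 2"] by auto
    have "Sup (A n) \<le> r / 2" if "n \<ge> n1" for n
      using n1[OF that] \<open>r > 0\<close> by (intro cSup_least) (auto simp: A_def)
    then have "\<eta> n \<le> r / 2" if "n \<ge> n1" for n
      using that \<open>r > 0\<close> by (simp add: \<eta>_def)
    then show "\<exists>no. \<forall>n\<ge>no. norm (\<eta> n - 0) < r"
      using nonneg \<open>r > 0\<close> by (intro exI[of _ n1]) fastforce
  qed
  moreover have "f n x \<le> \<eta> n" if "n \<ge> n0" "Q n x" for n x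
    using that by (intro up) (auto simp: A_def)
  ultimately show ?thesis using nonneg by blast
qed

theorem theorem1p1:
  shows "\<forall>\<delta>::real. \<delta> > 0 \<longrightarrow> (\<exists>\<tau>::real. \<tau> > 0 \<and> (\<forall>\<nu>::real. \<nu> > 0 \<longrightarrow>
    (\<exists>(n0::nat) (\<eta>::nat \<Rightarrow> real). (\<forall>n. \<eta> n \<ge> 0) \<and> \<eta> \<longlonglongrightarrow> 0 \<and>
      (\<forall>(n::nat) (d::nat) (V::'a set) (E::'a set set) (e::'a set).
         n \<ge> n0 \<and> even n \<and> real d \<ge> \<delta> * real n \<and>
         finite_simple_graph V E \<and> card V = n \<and> regular_graph d V E \<and>
         robust_expander \<nu> \<tau> V E \<and> e \<in> E \<longrightarrow>
         \<bar>real d * \<P>(M in random_perfect_matching V E. e \<in> M) - 1\<bar> \<le> \<eta> n))))"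
proof (intro allI impI)
  fix \<delta> :: real assume \<delta>: "\<delta> > 0"
  show "\<exists>\<tau>::real. \<tau> > 0 \<and> (\<forall>\<nu>::real. \<nu> > 0 \<longrightarrow>
    (\<exists>(n0::nat) (\<eta>::nat \<Rightarrow> real). (\<forall>n. \<eta> n \<ge> 0) \<and> \<eta> \<longlonglongrightarrow> 0 \<and>
      (\<forall>(n::nat) (d::nat) (V::'a set) (E::'a set set) (e::'a set).
         n \<ge> n0 \<and> even n \<and> real d \<ge> \<delta> * real n \<and>
         finite_simple_graph V E \<and> card V = n \<and> regular_graph d V E \<and>
         robust_expander \<nu> \<tau> V E \<and> e \<in> E \<longrightarrow>
         \<bar>real d * \<P>(M in random_perfect_matching V E. e \<in> M) - 1\<bar> \<le> \<eta> n)))"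
  proof (intro exI[of _ "\<delta> / 8"] conjI allI impI)
    fix \<nu> :: real assume \<nu>: "\<nu> > 0"
    \<comment> \<open>All data except \<open>n\<close> form one tuple, so that a single supremum
      covers all graphs, degrees and edges.\<close>
    define Q :: "nat \<Rightarrow> nat \<times> 'a set \<times> 'a set set \<times> 'a set \<Rightarrow> bool" where
      "Q n = (\<lambda>(d, V, E, e). even n \<and> real d \<ge> \<delta> * real n \<and>
         finite_simple_graph V E \<and> card V = n \<and> regular_graph d V E \<and>
         robust_expander \<nu> (\<delta> / 8) V E \<and> e \<in> E)" for n
    define f :: "nat \<Rightarrow> nat \<times> 'a set \<times> 'a set set \<times> 'a set \<Rightarrow> real" where
      "f n = (\<lambda>(d, V, E, e). \<bar>real d * \<P>(M in random_perfect_matching V E. e \<in> M) - 1\<bar>)" for n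
    have "\<exists>n0. \<forall>n\<ge>n0. \<forall>x. Q n x \<longrightarrow> f n x \<le> \<epsilon>" if "\<epsilon> > 0" for \<epsilon>
      using eventually_edge_prob[OF \<delta> \<nu> that, where 'a = 'a] unfolding Q_def f_def by fast
    then obtain n0 \<eta> where "\<forall>n. \<eta> n \<ge> 0" "\<eta> \<longlonglongrightarrow> 0" "\<forall>n\<ge>n0. \<forall>x. Q n x \<longrightarrow> f n x \<le> \<eta> n"
      using uniform_rate[of Q f] by blast
    then show "\<exists>(n0::nat) (\<eta>::nat \<Rightarrow> real). (\<forall>n. \<eta> n \<ge> 0) \<and> \<eta> \<longlonglongrightarrow> 0 \<and>
      (\<forall>(n::nat) (d::nat) (V::'a set) (E::'a set set) (e::'a set).
         n \<ge> n0 \<and> even n \<and> real d \<ge> \<delta> * real n \<and>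
         finite_simple_graph V E \<and> card V = n \<and> regular_graph d V E \<and>
         robust_expander \<nu> (\<delta> / 8) V E \<and> e \<in> E \<longrightarrow>
         \<bar>real d * \<P>(M in random_perfect_matching V E. e \<in> M) - 1\<bar> \<le> \<eta> n)"
      by (intro exI[of _ n0] exI[of _ \<eta>]) (auto simp: Q_def f_def)
  qed (use \<delta> in simp)
qed

end
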